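(* Let $0<|q|<1$, $\lambda\in\mathbb{C}^*\setminus q^{\mathbb{Z}}$, and let $\widetilde{\psi}^{\mathrm{A}}_\lambda(x)=\left(\mathcal{L}^+_{q,\lambda}\circ\mathcal{B}^+_q\,{}_1\psi_1\right)(0;b;q,x)$ be the $q$-Borel-Laplace transform of the divergent bilateral series ${}_1\psi_1(0;b;q,x)=\sum_{n\in\mathbb{Z}}\frac{1}{(b;q)_n}x^n$ with $b=q^\beta$. Then for any $x\in\mathbb{C}^*$, $$\lim_{q\to1-0}\widetilde{\psi}^{\mathrm{A}}_\lambda\big((1-q)x\big)=\Gamma(\beta)\,x^{1-\beta}\,e^{x}.$$
   Context: Notation. $(a;q)_0=1$, $(a;q)_n=(1-a)(1-aq)\cdots(1-aq^{n-1})$ for $n\ge1$, $(a;q)_n=\left[(1-aq^{-1})(1-aq^{-2})\cdots(1-aq^{n})\right]^{-1}$ for $n\le-1$, and $(a;q)_\infty=\lim_{n\to\infty}(a;q)_n$. The theta function is $\theta_q(z)=\sum_{n\in\mathbb{Z}}q^{n(n-1)/2}z^n$ for $z\in\mathbb{C}^*$. $\Gamma$ is the gamma function. $q$-Borel transformation: $(\mathcal{B}^+_qf)(\xi)=\sum_n a_nq^{n(n-1)/2}\xi^n$ for a formal series $f(x)=\sum_n a_nx^n$, applied here termwise to a bilateral series ($n\in\mathbb{Z}$). It sends ${}_1\psi_1(0;b;q,x)$ to $\psi_{\mathrm{A}}(\xi)=\sum_{n\in\mathbb{Z}}\frac{q^{n(n-1)/2}}{(b;q)_n}\xi^n$, which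 is evaluated, by a limiting case of Ramanujan's ${}_1\psi_1$ summation, as $\psi_{\mathrm{A}}(\xi)=\frac{(q;q)_\infty}{(b;q)_\infty}\frac{\theta_q(\xi)}{\theta_q(q\xi/b)}\left(-\frac{q\xi}{b};q\right)_\infty$. $q$-Laplace transformation: $(\mathcal{L}^+_{q,\lambda}\varphi)(x)=\sum_{n\in\mathbb{Z}}\frac{\varphi(\lambda q^n)}{\theta_q(\lambda q^n/x)}$. Thus $\widetilde{\psi}^{\mathrm{A}}_\lambda(x)=\sum_{n\in\mathbb{Z}}\frac{\psi_{\mathrm{A}}(\lambda q^n)}{\theta_q(\lambda q^n/x)}$.
   Formalization: For non-integer β, negative real λ or x/λ is excluded (the limit fails there, e.g. λ=−1 gives 0), x^{1−β} is the branch with arg x within π of Arg λ, β is not in {0,−1,−2,…}, and q→1 avoids values where a denominator θ_q(λq^n/((1−q)x)) vanishes. *)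

theory Defs
  imports "HOL-Complex_Analysis.Complex_Analysis"
begin

text \<open>
  Bilateral series over the integers are summed with \<^const>\<open>infsum\<close>, i.e. absolutely.  A (possibly
  divergent) bilateral series $\sum_n a_n x^n$ is represented by its coefficients
  \<open>a :: int \<Rightarrow> complex\<close>.
\<close>

definition qpoch :: "complex \<Rightarrow> complex \<Rightarrow> int \<Rightarrow> complex" where
  "qpoch a q n =
     (if n \<ge> 0 then \<Prod>k\<in>{0..<n}. 1 - a * q powi k
      else inverse (\<Prod>k\<in>{n..-1}. 1 - a * q powi k))"

definition theta :: "complex \<Rightarrow> complex \<Rightarrow> complex" where
  "theta q z = (\<Sum>\<^sub>\<infinity>n::int. q powi (n * (n - 1) div 2) * z powi n)"

text \<open>
  If the inverse defining \<open>qpoch b q n\<close> for some \<open>n < 0\<close> is that of zero (i.e. \<open>b\<close> is a positive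
  power of \<open>q\<close>), then \<open>1 / qpoch b q n = 0\<close>, which is the usual convention.
\<close>

definition one_psi_one :: "complex \<Rightarrow> complex \<Rightarrow> complex \<Rightarrow> int \<Rightarrow> complex" where
  "one_psi_one a b q n = qpoch a q n / qpoch b q n"

lemma one_psi_one_0: "one_psi_one 0 b q n = 1 / qpoch b q n"
  by (simp add: one_psi_one_def qpoch_def)

text \<open>
  The \<open>q\<close>-Laplace transformation evaluates the Borel transform at points where the transformed
  bilateral series need not converge (for \<open>1 / qpoch b q n\<close> it converges only for \<open>norm b < norm \<xi>\<close>
  unless it terminates to the left), so the Borel transform is the
  single-valued meromorphic continuation of its sum to the punctured plane. It is unique as soon as
  the series converges on a nonempty open set (see \<open>continues_bilateral_unique\<close>). At poles, the
  value is 0 by the convention of \<^const>\<open>nicely_meromorphic_on\<close>.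
\<close>

definition continues_bilateral :: "(complex \<Rightarrow> complex) \<Rightarrow> (int \<Rightarrow> complex) \<Rightarrow> bool" where
  "continues_bilateral f c \<longleftrightarrow>
     f nicely_meromorphic_on (-{0}) \<and>
     (\<forall>\<xi>. \<xi> \<noteq> 0 \<longrightarrow> (\<lambda>n. c n * \<xi> powi n) summable_on UNIV \<longrightarrow>
        f \<xi> = (\<Sum>\<^sub>\<infinity>n. c n * \<xi> powi n))"

lemma continues_bilateral_unique:
  assumes f: "continues_bilateral f c" and g: "continues_bilateral g c"
    and S: "open S" "S \<noteq> {}" "0 \<notin> S" "\<And>\<xi>. \<xi> \<in> S \<Longrightarrow> (\<lambda>n. c n * \<xi> powi n) summable_on UNIV"
    and z: "z \<noteq> 0"
  shows "f z = g z"
proof -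
  let ?A = "- {0 :: complex}"
  have A: "open ?A" "connected ?A"
    by (auto intro: connected_punctured_universe)
  have fm: "f nicely_meromorphic_on ?A" and gm: "g nicely_meromorphic_on ?A"
    using f g by (auto simp: continues_bilateral_def)
  have eqS: "f w = g w" if "w \<in> S" for w
  proof -
    have "w \<noteq> 0" using that S(3) by auto
    then show ?thesis
      using f g S(4)[OF that] unfolding continues_bilateral_def by presburger
  qed
  have "(\<lambda>w. f w - g w) meromorphic_on ?A"
    using fm gm by (auto simp: nicely_meromorphic_on_def intro: meromorphic_intros)
  then have "(\<forall>\<^sub>\<approx>w\<in>?A. f w - g w = 0) \<or> (\<forall>\<^sub>\<approx>w\<in>?A. f w - g w \<noteq> 0)"
    using meromorphic_imp_constant_or_avoid A by blast
  moreover have "\<not> (\<forall>\<^sub>\<approx>w\<in>?A. f w - g w \<noteq> 0)"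
  proof
    assume *: "\<forall>\<^sub>\<approx>w\<in>?A. f w - g w \<noteq> 0"
    obtain s where s: "s \<in> S" using S(2) by blast
    with S(3) have "s \<in> ?A" by auto
    with * have "\<forall>\<^sub>F w in at s. f w - g w \<noteq> 0"
      using A(1) by (simp add: eventually_cosparse_open_eq)
    moreover have "\<forall>\<^sub>F w in at s. w \<in> S"
      using S(1) s by (simp add: eventually_at_in_open')
    ultimately have "\<forall>\<^sub>F w in at s. False"
      by eventually_elim (use eqS in auto)
    then show False by simp
  qed
  ultimately have "\<forall>\<^sub>F w in at z. f w = g w"
    using A(1) z by (auto simp: eventually_cosparse_open_eq)
  then have pole: "is_pole f z \<longleftrightarrow> is_pole g z" and lim: "f \<midarrow>z\<rightarrow> a \<longleftrightarrow> g \<midarrow>z\<rightarrow> a" for a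
    by (auto intro!: is_pole_cong tendsto_cong)
  have "(is_pole f z \<and> f z = 0) \<or> f \<midarrow>z\<rightarrow> f z" "(is_pole g z \<and> g z = 0) \<or> g \<midarrow>z\<rightarrow> g z"
    using fm gm z by (auto simp: nicely_meromorphic_on_def)
  moreover have "\<not> (is_pole h z \<and> h \<midarrow>z\<rightarrow> a)" for h :: "complex \<Rightarrow> complex" and a
    using not_tendsto_and_filterlim_at_infinity[of "at z" h a] by (auto simp: is_pole_def)
  ultimately show ?thesis
    using pole lim LIM_unique by metis
qed

definition q_Borel :: "complex \<Rightarrow> (int \<Rightarrow> complex) \<Rightarrow> complex \<Rightarrow> complex" where
  "q_Borel q a = (SOME f. continues_bilateral f (\<lambda>n. a n * q powi (n * (n - 1) div 2)))"

definition q_Laplace :: "complex \<Rightarrow> complex \<Rightarrow> (complex \<Rightarrow> complex) \<Rightarrow> complex \<Rightarrow> complex" where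
  "q_Laplace q lam \<phi> x = (\<Sum>\<^sub>\<infinity>n::int. \<phi> (lam * q powi n) / theta q (lam * q powi n / x))"

text \<open>
  The branch of \<open>x\<^sup>s\<close> on the plane slit along the ray from 0 through \<open>-lam\<close> that has the principal
  value at \<open>x = lam\<close>, i.e. \<open>arg x\<close> is taken within \<open>\<pi>\<close> of the principal argument of \<open>lam\<close>
  (see \<open>branch_powr_exp\<close>). It is the branch that arises as the limit for \<open>q \<longlonglongrightarrow> 1\<close> of the quotient
  \<open>theta q lam * theta q (q * lam / (b * x)) / (theta q (q * lam / b) * theta q (lam / x))\<close> with
  \<open>b = q powr \<beta>\<close> and \<open>s = 1 - \<beta>\<close>. If \<open>\<beta>\<close> is not an integer and \<open>lam\<close> or \<open>x / lam\<close> is a negative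
  real, one passes arbitrarily close to zeros of these theta functions as \<open>q\<close> approaches 1, and
  the asserted limit fails. For integer \<open>\<beta>\<close>, the quotient is an exact monomial in \<open>x\<close>.
\<close>

definition branch_powr :: "complex \<Rightarrow> complex \<Rightarrow> complex \<Rightarrow> complex" where
  "branch_powr lam x s = lam powr s * (x / lam) powr s"

lemma branch_powr_exp:
  assumes "lam \<noteq> 0" and "exp y = x" and "\<bar>Im y - Arg lam\<bar> < pi"
  shows "branch_powr lam x s = exp (s * y)"
proof -
  have "Ln (exp (y - Ln lam)) = y - Ln lam"
    using assms by (intro Ln_exp) (auto simp: Arg_eq_Im_Ln)
  moreover have "exp (y - Ln lam) = x / lam"
    using assms by (simp add: exp_diff)
  ultimately have "Ln (x / lam) = y - Ln lam" by simp
  then have "Ln lam + Ln (x / lam) = y" by simp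
  then have "s * Ln lam + s * Ln (x / lam) = s * y"
    by (metis distrib_left)
  moreover have "x \<noteq> 0" using assms by auto
  ultimately show ?thesis
    using assms(1) by (simp add: branch_powr_def powr_def exp_add [symmetric])
qed

lemma branch_powr_of_real:
  assumes "r > 0"
  shows "branch_powr (of_real r) x s = x powr s"
proof (cases "x = 0")
  case False
  have "Ln (x / of_real r) = Ln x - of_real (ln r)"
    using assms False by (subst Ln_divide_of_real) auto
  then have "of_real (ln r) + Ln (x / of_real r) = Ln x" by simp
  then have "s * of_real (ln r) + s * Ln (x / of_real r) = s * Ln x"
    by (metis distrib_left)
  with assms False show ?thesis
    by (simp add: branch_powr_def powr_def Ln_of_real exp_add [symmetric] del: Ln_divide_of_real)
qed (simp add: branch_powr_def)

lemma branch_powr_of_int: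
  assumes "lam \<noteq> 0" and "x \<noteq> 0"
  shows "branch_powr lam x (of_int n) = x powi n"
  using assms
  by (simp add: branch_powr_def complex_powr_of_int power_int_mult_distrib [symmetric])

end

theory Submission
  imports Defs
begin

text \<open>
  Write \<open>E a = (a; q)\<^sub>\<infinity>\<close>. Expanding \<open>E (a q\<^sup>n)\<close> by Euler's series and using
  \<open>\<theta> (q z) = \<theta> z / z\<close> sums the bilateral series of all \<open>E (a q\<^sup>n) q powi (n (n - 1) / 2) z\<^sup>n\<close>
  to \<open>\<theta> z / E (- a / z)\<close>. Since \<open>1 / (b; q)\<^sub>n = E (b q\<^sup>n) / E b\<close>, this evaluates the Borel transform;
  its values at \<open>\<lambda> q\<^sup>n\<close> are again of the form \<open>A (q / b)\<^sup>n E (a q\<^sup>n)\<close> with \<open>a = - q \<lambda> / b\<close>, so the same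
  sum evaluates the Laplace transform. With \<open>s = 1 - \<beta>\<close> the result at \<open>X\<close> is
  \<open>E q / E b / E X\<close> times the quotient of \<open>\<theta> (q\<^sup>s \<lambda> / X) / \<theta> (\<lambda> / X)\<close> by \<open>\<theta> (q\<^sup>s \<lambda>) / \<theta> \<lambda>\<close>.

  For \<open>q = exp (- h)\<close>, logarithms of quotients such as \<open>E (q\<^sup>s z) / E z\<close> are sums of differences
  \<open>f (a\<^sub>k + s d) - f (a\<^sub>k)\<close> along an arithmetic progression \<open>a\<^sub>k\<close> of step \<open>d\<close>. Up to an error
  controlled by the second derivative of \<open>f\<close> they equal \<open>s (f (a\<^sub>k\<^sub>+\<^sub>1) - f (a\<^sub>k))\<close>, which telescopes.
  For \<open>f v = Ln (1 + exp v)\<close> this gives \<open>\<theta> (q\<^sup>s z) / \<theta> z \<longrightarrow> z powr (- s)\<close>, uniformly in \<open>norm z\<close>, and for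
  \<open>f t = Ln (1 - exp (- h t))\<close> it gives the limit of the \<open>q\<close>-Gamma function.
\<close>

section \<open>Euler's series for the infinite product\<close>

text \<open>These are $(-1)^m q^{m(m-1)/2} / (q;q)_m$ and $1 / (q;q)_m$.\<close>

fun E_coeff :: "complex \<Rightarrow> nat \<Rightarrow> complex" where
  "E_coeff q 0 = 1"
| "E_coeff q (Suc m) = - E_coeff q m * q ^ m / (1 - q ^ Suc m)"

fun e_coeff :: "complex \<Rightarrow> nat \<Rightarrow> complex" where
  "e_coeff q 0 = 1"
| "e_coeff q (Suc m) = e_coeff q m / (1 - q ^ Suc m)"

text \<open>Defining the infinite product by Euler's series makes it entire in \<open>a\<close> at
  once and supplies the coefficients for the interchange of sums in \<open>bilateral_sum\<close>;
  \<open>qpoch_inf_LIMSEQ\<close> recovers the product.\<close>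

definition qpoch_inf :: "complex \<Rightarrow> complex \<Rightarrow> complex" where
  "qpoch_inf a q = (\<Sum>m. E_coeff q m * a ^ m)"

lemma one_minus_power_nonzero:
  fixes q :: complex
  assumes "norm q < 1"
  shows "1 - q ^ Suc m \<noteq> 0"
proof
  assume "1 - q ^ Suc m = 0"
  then have "norm q ^ Suc m = 1"
    by (metis eq_iff_diff_eq_0 norm_one norm_power)
  moreover have "norm q ^ Suc m < 1"
    using assms by (intro power_less_one_iff[THEN iffD2]) auto
  ultimately show False by simp
qed

lemma summable_norm_E_coeff:
  assumes q: "norm q < 1"
  shows "summable (\<lambda>m. norm (E_coeff q m * a ^ m))"
proof -
  have "(\<lambda>m. norm (q ^ m * a / (1 - q ^ Suc m))) \<longlonglongrightarrow> norm (0 * a / (1 - 0))"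
    by (intro tendsto_intros LIMSEQ_power_zero filterlim_compose[OF LIMSEQ_power_zero[OF q]] filterlim_Suc q) auto
  then have "\<forall>\<^sub>F m in sequentially. norm (q ^ m * a / (1 - q ^ Suc m)) < 1/2"
    by (intro order_tendstoD(2)) auto
  then obtain N where N: "\<And>m. m \<ge> N \<Longrightarrow> norm (q ^ m * a / (1 - q ^ Suc m)) < 1/2"
    by (auto simp: eventually_sequentially)
  show ?thesis
  proof (rule summable_ratio_test[of "1/2" N])
    fix m assume "N \<le> m"
    then have "norm (q ^ m * a / (1 - q ^ Suc m)) * norm (E_coeff q m * a ^ m) \<le> 1/2 * norm (E_coeff q m * a ^ m)"
      using N[of m] by (intro mult_right_mono) auto
    then show "norm (norm (E_coeff q (Suc m) * a ^ Suc m)) \<le> 1 / 2 * norm (norm (E_coeff q m * a ^ m))"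
      by (simp add: norm_mult norm_divide mult_ac)
  qed auto
qed

lemma summable_E_coeff:
  assumes q: "norm q < 1"
  shows "summable (\<lambda>m. E_coeff q m * a ^ m)"
  using summable_norm_cancel[OF summable_norm_E_coeff[OF q]] .

lemma summable_norm_e_coeff:
  assumes q: "norm q < 1" and a: "norm a < 1"
  shows "summable (\<lambda>m. norm (e_coeff q m * a ^ m))"
proof -
  obtain r where r: "norm a < r" "r < 1" using dense a by blast
  have "(\<lambda>m. norm (a / (1 - q ^ Suc m))) \<longlonglongrightarrow> norm (a / (1 - 0))"
    by (intro tendsto_intros LIMSEQ_power_zero filterlim_compose[OF LIMSEQ_power_zero[OF q]] filterlim_Suc q) auto
  then have "\<forall>\<^sub>F m in sequentially. norm (a / (1 - q ^ Suc m)) < r"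
    using r by (intro order_tendstoD(2)) auto
  then obtain N where N: "\<And>m. m \<ge> N \<Longrightarrow> norm (a / (1 - q ^ Suc m)) < r"
    by (auto simp: eventually_sequentially)
  show ?thesis
  proof (rule summable_ratio_test[of r N])
    fix m assume "N \<le> m"
    then have "norm (a / (1 - q ^ Suc m)) * norm (e_coeff q m * a ^ m) \<le> r * norm (e_coeff q m * a ^ m)"
      using N[of m] by (intro mult_right_mono) auto
    then show "norm (norm (e_coeff q (Suc m) * a ^ Suc m)) \<le> r * norm (norm (e_coeff q m * a ^ m))"
      by (simp add: norm_mult norm_divide mult_ac)
  qed (use r in auto)
qed

section \<open>Functional equation, product form and zeros of Euler's series\<close>

lemma qpoch_inf_0 [simp]: "qpoch_inf 0 q = 1"
  unfolding qpoch_inf_def by (subst suminf_finite[of "{0}"]) auto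

text \<open>Replacing \<open>a\<close> by \<open>a * q\<close> multiplies the \<open>m\<close>-th
  term by \<open>q ^ m\<close>, so the difference of the two series carries the factor
  \<open>1 - q ^ m\<close>, the denominator in the recursion of \<open>E_coeff\<close>. After an
  index shift the difference is \<open>- a\<close> times the series at \<open>a * q\<close>.\<close>

lemma qpoch_inf_rec:
  assumes q: "norm q < 1"
  shows "qpoch_inf a q = (1 - a) * qpoch_inf (a * q) q"
proof -
  let ?c = "E_coeff q"
  note S = summable_E_coeff[OF q]
  have "qpoch_inf a q - qpoch_inf (a * q) q = (\<Sum>m. ?c m * a ^ m - ?c m * (a * q) ^ m)"
    unfolding qpoch_inf_def by (rule suminf_diff[OF S S])
  also have "\<dots> = (\<Sum>m. ?c (Suc m) * a ^ Suc m - ?c (Suc m) * (a * q) ^ Suc m)"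
    by (subst suminf_split_head[OF summable_diff[OF S S]]) simp
  also have "\<dots> = (\<Sum>m. - a * (?c m * (a * q) ^ m))"
  proof (rule suminf_cong)
    fix m
    have "?c (Suc m) * a ^ Suc m - ?c (Suc m) * (a * q) ^ Suc m = ?c (Suc m) * (1 - q ^ Suc m) * a ^ Suc m"
      by (simp add: algebra_simps power_mult_distrib del: E_coeff.simps power_Suc)
    also have "?c (Suc m) * (1 - q ^ Suc m) = - ?c m * q ^ m"
      using one_minus_power_nonzero[OF q, of m] by simp
    finally show "?c (Suc m) * a ^ Suc m - ?c (Suc m) * (a * q) ^ Suc m = - a * (?c m * (a * q) ^ m)"
      by (simp add: algebra_simps power_mult_distrib)
  qed
  also have "\<dots> = - a * qpoch_inf (a * q) q"
    unfolding qpoch_inf_def by (rule suminf_mult[OF S])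
  finally show ?thesis by (simp add: algebra_simps)
qed

lemma qpoch_inf_holomorphic:
  assumes q: "norm q < 1"
  shows "(\<lambda>a. qpoch_inf a q) holomorphic_on UNIV"
proof -
  have "((\<lambda>z. \<Sum>n. E_coeff q n * z ^ n) has_field_derivative (\<Sum>n. diffs (E_coeff q) n * z ^ n)) (at z)" for z
    by (rule termdiffs_strong_converges_everywhere) (rule summable_E_coeff[OF q])
  then show ?thesis
    unfolding qpoch_inf_def holomorphic_on_def field_differentiable_def by (auto intro: DERIV_subset)
qed

lemma isCont_qpoch_inf:
  assumes q: "norm q < 1"
  shows "isCont (\<lambda>a. qpoch_inf a q) a"
  using holomorphic_on_imp_continuous_on[OF qpoch_inf_holomorphic[OF q]]
  by (simp add: continuous_on_eq_continuous_at)

lemma qpoch_inf_analytic [analytic_intros]: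
  assumes "norm q < 1" "f analytic_on S"
  shows "(\<lambda>z. qpoch_inf (f z) q) analytic_on S"
proof -
  have "(\<lambda>a. qpoch_inf a q) analytic_on UNIV"
    using qpoch_inf_holomorphic[OF assms(1)] by (simp add: analytic_on_open)
  from analytic_on_compose_gen[OF assms(2) this] show ?thesis
    by (simp add: o_def)
qed

lemma qpoch_inf_split:
  assumes q: "norm q < 1"
  shows "qpoch_inf a q = (\<Prod>k<n. 1 - a * q ^ k) * qpoch_inf (a * q ^ n) q"
proof (induction n)
  case (Suc n)
  then show ?case
    using qpoch_inf_rec[OF q, of "a * q ^ n"] by (simp add: mult_ac)
qed simp

lemma qpoch_inf_shift_tendsto:
  assumes q: "norm q < 1"
  shows "(\<lambda>n. qpoch_inf (a * q ^ n) q) \<longlonglongrightarrow> 1"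
proof -
  have "(\<lambda>n. a * q ^ n) \<longlonglongrightarrow> a * 0"
    by (intro tendsto_intros LIMSEQ_power_zero q)
  then have "(\<lambda>n. qpoch_inf (a * q ^ n) q) \<longlonglongrightarrow> qpoch_inf (a * 0) q"
    by (rule isCont_tendsto_compose[OF isCont_qpoch_inf[OF q]])
  then show ?thesis by simp
qed

lemma qpoch_inf_LIMSEQ:
  assumes q: "norm q < 1"
  shows "(\<lambda>n. \<Prod>k<n. 1 - a * q ^ k) \<longlonglongrightarrow> qpoch_inf a q"
proof -
  have "(\<lambda>n. qpoch_inf a q / qpoch_inf (a * q ^ n) q) \<longlonglongrightarrow> qpoch_inf a q / 1"
    by (intro tendsto_intros qpoch_inf_shift_tendsto q) auto
  moreover have "\<forall>\<^sub>F n in sequentially. qpoch_inf (a * q ^ n) q \<noteq> 0"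
    using tendsto_imp_eventually_ne[OF qpoch_inf_shift_tendsto[OF q]] by auto
  then have "\<forall>\<^sub>F n in sequentially. qpoch_inf a q / qpoch_inf (a * q ^ n) q = (\<Prod>k<n. 1 - a * q ^ k)"
  proof eventually_elim
    case (elim n)
    then show ?case using qpoch_inf_split[OF q, of a n] by simp
  qed
  ultimately show ?thesis
    by (simp cong: filterlim_cong)
qed

text \<open>The tail \<open>qpoch_inf (a * q ^ n) q\<close> tends to 1 and is nonzero for large
  \<open>n\<close>; a zero must therefore come from one of the finitely many factors split
  off.\<close>

lemma qpoch_inf_nonzero_iff:
  assumes q: "norm q < 1"
  shows "qpoch_inf a q \<noteq> 0 \<longleftrightarrow> (\<forall>k. 1 - a * q ^ k \<noteq> 0)"
proof
  assume *: "\<forall>k. 1 - a * q ^ k \<noteq> 0"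
  have "\<forall>\<^sub>F n in sequentially. qpoch_inf (a * q ^ n) q \<noteq> 0"
    using tendsto_imp_eventually_ne[OF qpoch_inf_shift_tendsto[OF q]] by auto
  then obtain n where "qpoch_inf (a * q ^ n) q \<noteq> 0"
    by (auto simp: eventually_sequentially)
  then show "qpoch_inf a q \<noteq> 0"
    using * by (subst qpoch_inf_split[OF q, of _ n]) auto
next
  assume *: "qpoch_inf a q \<noteq> 0"
  show "\<forall>k. 1 - a * q ^ k \<noteq> 0"
  proof
    fix k show "1 - a * q ^ k \<noteq> 0"
      using * qpoch_inf_split[OF q, of a "Suc k"] by auto
  qed
qed

lemma qpoch_inf_nonzero:
  assumes q: "norm q < 1" and a: "norm a < 1"
  shows "qpoch_inf a q \<noteq> 0"
  unfolding qpoch_inf_nonzero_iff[OF q]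
proof
  fix k
  have "norm (a * q ^ k) \<le> norm a * 1"
    unfolding norm_mult norm_power using q by (intro mult_left_mono power_le_one) auto
  then show "1 - a * q ^ k \<noteq> 0" using a by auto
qed

text \<open>The series \<open>e\<close> and \<open>qpoch_inf\<close> satisfy reciprocal first-order
  q-difference equations, so their product is unchanged when \<open>a\<close> becomes
  \<open>a * q\<close>. Iterating drives the argument to 0, where by continuity the product is
  1.\<close>

lemma e_coeff_suminf:
  assumes q: "norm q < 1" and a: "norm a < 1"
  shows "(\<Sum>m. e_coeff q m * a ^ m) = 1 / qpoch_inf a q"
proof -
  let ?d = "e_coeff q"
  define e where "e a = (\<Sum>m. ?d m * a ^ m)" for a
  have S: "summable (\<lambda>m. ?d m * a ^ m)" if "norm a < 1" for a
    using summable_norm_cancel[OF summable_norm_e_coeff[OF q that]] .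
  have smaller: "norm (a * q) < 1" if "norm a < 1" for a
  proof -
    have "norm a * norm q \<le> norm a * 1" using q by (intro mult_left_mono) auto
    then show ?thesis using that by (simp add: norm_mult)
  qed
  have rec: "e (a * q) = (1 - a) * e a" if a: "norm a < 1" for a
  proof -
    note S1 = S[OF a] and S2 = S[OF smaller[OF a]]
    have "e a - e (a * q) = (\<Sum>m. ?d m * a ^ m - ?d m * (a * q) ^ m)"
      unfolding e_def by (rule suminf_diff[OF S1 S2])
    also have "\<dots> = (\<Sum>m. ?d (Suc m) * a ^ Suc m - ?d (Suc m) * (a * q) ^ Suc m)"
      by (subst suminf_split_head[OF summable_diff[OF S1 S2]]) simp
    also have "\<dots> = (\<Sum>m. a * (?d m * a ^ m))"
    proof (rule suminf_cong)
      fix m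
      have "?d (Suc m) * a ^ Suc m - ?d (Suc m) * (a * q) ^ Suc m = ?d (Suc m) * (1 - q ^ Suc m) * a ^ Suc m"
        by (simp add: algebra_simps power_mult_distrib del: e_coeff.simps power_Suc)
      also have "?d (Suc m) * (1 - q ^ Suc m) = ?d m"
        using one_minus_power_nonzero[OF q, of m] by simp
      finally show "?d (Suc m) * a ^ Suc m - ?d (Suc m) * (a * q) ^ Suc m = a * (?d m * a ^ m)"
        by (simp add: algebra_simps)
    qed
    also have "\<dots> = a * e a"
      unfolding e_def by (rule suminf_mult[OF S1])
    finally show ?thesis by (simp add: algebra_simps)
  qed
  have small: "norm (a * q ^ n) < 1" for n
    using smaller[of "a * q ^ m" for m] a by (induction n) (auto simp: mult_ac)
  have prod: "e a * qpoch_inf a q = e (a * q ^ n) * qpoch_inf (a * q ^ n) q" for n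
  proof (induction n)
    case (Suc n)
    then show ?case
      using rec[OF small[of n]] qpoch_inf_rec[OF q, of "a * q ^ n"] by (simp add: mult_ac)
  qed simp
  have "isCont e 0"
    unfolding e_def using S[of "1/2"] by (intro isCont_powser[where K = "1/2"]) auto
  moreover have "(\<lambda>n. a * q ^ n) \<longlonglongrightarrow> a * 0"
    by (intro tendsto_intros LIMSEQ_power_zero q)
  ultimately have "(\<lambda>n. e (a * q ^ n)) \<longlonglongrightarrow> e 0"
    using isCont_tendsto_compose[of 0 e "\<lambda>n. a * q ^ n"] by simp
  moreover have "e 0 = 1"
    unfolding e_def by (subst suminf_finite[of "{0}"]) auto
  ultimately have "(\<lambda>n. e (a * q ^ n) * qpoch_inf (a * q ^ n) q) \<longlonglongrightarrow> 1 * 1"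
    using qpoch_inf_shift_tendsto[OF q] by (intro tendsto_mult) auto
  then have "(\<lambda>n::nat. e a * qpoch_inf a q) \<longlonglongrightarrow> 1"
    unfolding prod[symmetric] by simp
  then have "e a * qpoch_inf a q = 1"
    by (simp add: LIMSEQ_const_iff)
  then show ?thesis
    using qpoch_inf_nonzero[OF q a] by (simp add: e_def field_simps)
qed

section \<open>Theta function and bilateral summation\<close>

text \<open>The general term of the theta series is also its automorphy factor: by
  \<open>theta_shift_int\<close>,
  \<open>theta q (q powi n * z) * theta_term q z n = theta q z\<close>.\<close>

definition theta_term :: "complex \<Rightarrow> complex \<Rightarrow> int \<Rightarrow> complex" where
  "theta_term q z n = q powi (n * (n - 1) div 2) * z powi n"

lemma triangular_int_add_1: "(n + 1) * (n + 1 - 1) div 2 = n * (n - 1) div 2 + (n::int)"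
proof -
  have "(n + 1) * (n + 1 - 1) = n * (n - 1) + n * 2" by (simp add: algebra_simps)
  then show ?thesis by (simp only: div_mult_self1 zero_neq_numeral)
qed

lemma theta_term_succ:
  assumes "q \<noteq> 0" "z \<noteq> 0"
  shows "theta_term q z (n + 1) = z * q powi n * theta_term q z n"
  unfolding theta_term_def triangular_int_add_1 using assms by (simp add: power_int_add)

lemma theta_term_shift:
  assumes "q \<noteq> 0" "z \<noteq> 0"
  shows "theta_term q (q * z) n = theta_term q z (n + 1) / z"
  unfolding theta_term_succ[OF assms]
  using assms by (simp add: theta_term_def power_int_mult_distrib)

lemma abs_summable_on_int:
  fixes f :: "int \<Rightarrow> 'a::banach"
  assumes "summable (\<lambda>n. norm (f (int n)))" "summable (\<lambda>n. norm (f (- int n)))"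
  shows "(\<lambda>n. norm (f n)) summable_on UNIV"
proof -
  have "(\<lambda>n. norm (f (int n))) summable_on UNIV" "(\<lambda>n. norm (f (- int n))) summable_on UNIV"
    using assms by (intro norm_summable_imp_summable_on; simp)+
  then have "(\<lambda>n. norm (f n)) summable_on range int" "(\<lambda>n. norm (f n)) summable_on range (\<lambda>n. - int n)"
    by (simp_all add: summable_on_reindex inj_def o_def)
  then have "(\<lambda>n. norm (f n)) summable_on (range int \<union> range (\<lambda>n. - int n))"
    by (rule summable_on_union)
  also have "range int \<union> range (\<lambda>n. - int n) = UNIV"
  proof -
    have "n \<in> range int \<union> range (\<lambda>n. - int n)" for n
      by (cases n rule: int_cases2) auto
    then show ?thesis by blast
  qed
  finally show ?thesis .
qed

lemma summable_norm_of_ratio_tendsto_0: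
  fixes f :: "nat \<Rightarrow> complex"
  assumes "\<And>n. f (Suc n) = r n * f n" "r \<longlonglongrightarrow> 0"
  shows "summable (\<lambda>n. norm (f n))"
proof -
  have "\<forall>\<^sub>F n in sequentially. norm (r n) < 1/2"
    using tendsto_norm_zero[OF assms(2)] by (rule order_tendstoD) simp
  then obtain N where N: "\<And>m. m \<ge> N \<Longrightarrow> norm (r m) < 1/2"
    by (auto simp: eventually_sequentially)
  show ?thesis
  proof (rule summable_ratio_test[of "1/2" N])
    fix n assume "N \<le> n"
    then have "norm (r n) * norm (f n) \<le> 1/2 * norm (f n)"
      using N[of n] by (intro mult_right_mono) auto
    then show "norm (norm (f (Suc n))) \<le> 1/2 * norm (norm (f n))"
      by (simp add: assms(1) norm_mult)
  qed auto
qed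

section \<open>Quasi-periodicity of theta and the bilateral sum\<close>

context
  fixes q :: complex
  assumes q: "norm q < 1" and q0: "q \<noteq> 0"
begin

text \<open>The ratio of neighbouring terms is \<open>z * q ^ n\<close> going up and
  \<open>q ^ (n + 1) / z\<close> going down; both tend to 0.\<close>

lemma theta_term_abs_summable:
  assumes z: "z \<noteq> 0"
  shows "(\<lambda>n. norm (theta_term q z n)) summable_on UNIV"
proof (rule abs_summable_on_int)
  show "summable (\<lambda>n. norm (theta_term q z (int n)))"
  proof (rule summable_norm_of_ratio_tendsto_0)
    show "theta_term q z (int (Suc n)) = (z * q ^ n) * theta_term q z (int n)" for n
      using theta_term_succ[OF q0 z, of "int n"] by (simp add: add.commute)
    show "(\<lambda>n. z * q ^ n) \<longlonglongrightarrow> 0"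
      by (intro tendsto_mult_right_zero LIMSEQ_power_zero q)
  qed
  show "summable (\<lambda>n. norm (theta_term q z (- int n)))"
  proof (rule summable_norm_of_ratio_tendsto_0)
    show "theta_term q z (- int (Suc n)) = (inverse z * q ^ Suc n) * theta_term q z (- int n)" for n
    proof -
      have "theta_term q z (- int n) = z * q powi (- int (Suc n)) * theta_term q z (- int (Suc n))"
        using theta_term_succ[OF q0 z, of "- int (Suc n)"] by simp
      also have "q powi (- int (Suc n)) = inverse (q ^ Suc n)"
        by (metis power_int_minus power_int_of_nat)
      finally have "theta_term q z (- int n) * q ^ Suc n =
          z * theta_term q z (- int (Suc n)) * (inverse (q ^ Suc n) * q ^ Suc n)"
        by (simp only: mult_ac)
      also have "inverse (q ^ Suc n) * q ^ Suc n = 1"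
        using q0 by (intro left_inverse) auto
      finally have "theta_term q z (- int n) * q ^ Suc n = z * theta_term q z (- int (Suc n))"
        by (simp only: mult_1_right)
      then show ?thesis using z by (simp add: divide_simps mult_ac)
    qed
    show "(\<lambda>n. inverse z * q ^ Suc n) \<longlonglongrightarrow> 0"
      by (intro tendsto_mult_right_zero LIMSEQ_Suc LIMSEQ_power_zero q)
  qed
qed

lemma theta_term_has_sum:
  assumes z: "z \<noteq> 0"
  shows "(theta_term q z has_sum theta q z) UNIV"
proof -
  have "theta_term q z summable_on UNIV"
    using theta_term_abs_summable[OF z] by (rule abs_summable_summable)
  then show ?thesis
    unfolding theta_def theta_term_def[symmetric] by (rule has_sum_infsum)
qed

lemma theta_shift:
  assumes z: "z \<noteq> 0"
  shows "theta q (q * z) = theta q z / z"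
proof -
  have "bij_betw (\<lambda>n::int. n + 1) UNIV UNIV"
    by (rule bij_betwI[of _ _ _ "\<lambda>n. n - 1"]) auto
  then have "((\<lambda>n. theta_term q z (n + 1)) has_sum theta q z) UNIV"
    using theta_term_has_sum[OF z] has_sum_reindex_bij_betw by fast
  then have "((\<lambda>n. theta_term q z (n + 1) * (1 / z)) has_sum theta q z * (1 / z)) UNIV"
    by (rule has_sum_cmult_left)
  then have "(theta_term q (q * z) has_sum theta q z / z) UNIV"
    unfolding theta_term_shift[OF q0 z, abs_def] by simp
  moreover have "(theta_term q (q * z) has_sum theta q (q * z)) UNIV"
    using z q0 by (intro theta_term_has_sum) auto
  ultimately show ?thesis
    using has_sum_unique by blast
qed

text \<open>Iterating \<open>theta_shift\<close> gives \<open>theta q (q ^ m * z)\<close> a factor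
  \<open>q\<close> to the power \<open>- m * (m - 1) / 2\<close>, which cancels the Gaussian part of
  \<open>E_coeff\<close> and leaves \<open>e_coeff\<close>. This turns Euler's first series into his
  second one.\<close>

lemma E_coeff_theta:
  assumes z: "z \<noteq> 0"
  shows "E_coeff q m * theta q (q ^ m * z) = e_coeff q m * (- 1 / z) ^ m * theta q z"
proof (induction m)
  case (Suc m)
  have "theta q (q ^ Suc m * z) = theta q (q ^ m * z) / (q ^ m * z)"
    using theta_shift[of "q ^ m * z"] z q0 by (simp add: mult.assoc)
  then have "theta q (q ^ m * z) = theta q (q ^ Suc m * z) * (q ^ m * z)"
    using z q0 by simp
  then have "E_coeff q (Suc m) * theta q (q ^ Suc m * z) =
      - (E_coeff q m * theta q (q ^ m * z)) / (z * (1 - q ^ Suc m))"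
    using z by simp
  also have "\<dots> = e_coeff q (Suc m) * (- 1 / z) ^ Suc m * theta q z"
    unfolding Suc.IH by simp
  finally show ?case .
qed simp

text \<open>The same cancellation for absolute values: these are the row sums that justify
  interchanging the two summations in \<open>bilateral_sum\<close>. Each induction step shifts the
  bilateral index by one.\<close>

lemma norm_E_coeff_theta:
  assumes z: "z \<noteq> 0"
  shows "((\<lambda>n. norm (E_coeff q m * theta_term q (q ^ m * z) n)) has_sum
    (norm (e_coeff q m * (1 / z) ^ m) * (\<Sum>\<^sub>\<infinity>n. norm (theta_term q z n)))) UNIV"
proof (induction m)
  case 0
  then show ?case
    using theta_term_abs_summable[OF z] by simp
next
  case (Suc m)
  have bij: "bij_betw (\<lambda>n::int. n + 1) UNIV UNIV"
    by (rule bij_betwI[of _ _ _ "\<lambda>n. n - 1"]) auto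
  have eq: "norm (E_coeff q (Suc m) * theta_term q (q ^ Suc m * z) n) =
      norm (E_coeff q m * theta_term q (q ^ m * z) (n + 1)) * norm (1 / (z * (1 - q ^ Suc m)))" for n
  proof -
    have "theta_term q (q ^ Suc m * z) n = theta_term q (q ^ m * z) (n + 1) / (q ^ m * z)"
      using theta_term_shift[of q "q ^ m * z"] z q0 by (simp add: mult.assoc)
    then show ?thesis
      using q0 z by (simp add: norm_mult norm_divide)
  qed
  have "((\<lambda>n. norm (E_coeff q m * theta_term q (q ^ m * z) (n + 1))) has_sum
    (norm (e_coeff q m * (1 / z) ^ m) * (\<Sum>\<^sub>\<infinity>n. norm (theta_term q z n)))) UNIV"
    using Suc.IH
    by (subst has_sum_reindex_bij_betw[OF bij, where f = "\<lambda>n. norm (E_coeff q m * theta_term q (q ^ m * z) n)"])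
  from has_sum_cmult_left[OF this, of "norm (1 / (z * (1 - q ^ Suc m)))"]
  show ?case
    unfolding eq by (simp add: norm_mult norm_divide mult_ac)
qed

text \<open>The double series \<open>F\<close> is summed in both orders. Columns (fixed
  \<open>n\<close>) are Euler series for \<open>qpoch_inf (a * q powi n) q\<close>; rows (fixed
  \<open>m\<close>) are theta series, and their sums form the reciprocal Euler series in
  \<open>- a / z\<close>, whence the condition \<open>norm a < norm z\<close>.\<close>

lemma bilateral_sum:
  assumes z: "z \<noteq> 0" and a: "norm a < norm z"
  shows "((\<lambda>n. qpoch_inf (a * q powi n) q * theta_term q z n) has_sum
    theta q z / qpoch_inf (- a / z) q) UNIV"
proof -
  define F where "F = (\<lambda>(m, n). E_coeff q m * a ^ m * theta_term q (q ^ m * z) n)"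
  define T where "T = (\<Sum>\<^sub>\<infinity>n. norm (theta_term q z n))"
  have small: "norm (a / z) < 1" "norm (- a / z) < 1"
    using z a by (auto simp: norm_divide)
  have "(\<lambda>x. norm (F x)) summable_on (UNIV \<times> UNIV)"
  proof (rule summable_on_SigmaI)
    fix m
    show "((\<lambda>n. norm (F (m, n))) has_sum (norm (e_coeff q m * (a / z) ^ m) * T)) UNIV"
      using has_sum_cmult_left[OF norm_E_coeff_theta[OF z, of m], of "norm (a ^ m)"]
      by (simp add: F_def T_def norm_mult norm_divide norm_power power_divide mult_ac)
  next
    have "summable (\<lambda>m. norm (e_coeff q m * (a / z) ^ m) * T)"
      by (intro summable_mult2 summable_norm_e_coeff q small)
    moreover have "T \<ge> 0" unfolding T_def by (intro infsum_nonneg) auto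
    ultimately show "(\<lambda>m. norm (e_coeff q m * (a / z) ^ m) * T) summable_on UNIV"
      by (intro norm_summable_imp_summable_on) simp
  qed auto
  then have "F summable_on (UNIV \<times> UNIV)"
    by (rule abs_summable_summable)
  then obtain S where S: "(F has_sum S) (UNIV \<times> UNIV)"
    by (auto simp: summable_on_def)
  have rows: "((\<lambda>n. F (m, n)) has_sum e_coeff q m * (- a / z) ^ m * theta q z) UNIV" for m
  proof -
    have "q ^ m * z \<noteq> 0" using z q0 by auto
    from has_sum_cmult_right[OF theta_term_has_sum[OF this], of "E_coeff q m * a ^ m"]
    have "((\<lambda>n. F (m, n)) has_sum E_coeff q m * a ^ m * theta q (q ^ m * z)) UNIV"
      by (simp add: F_def)
    also have "E_coeff q m * a ^ m * theta q (q ^ m * z) = a ^ m * (E_coeff q m * theta q (q ^ m * z))"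
      by simp
    also have "\<dots> = e_coeff q m * (- a / z) ^ m * theta q z"
    proof -
      have "(- a / z) ^ m = (a * (- 1 / z)) ^ m" by simp
      then show ?thesis
        unfolding E_coeff_theta[OF z] power_mult_distrib by (simp only: mult_ac)
    qed
    finally show ?thesis .
  qed
  have "((\<lambda>m. e_coeff q m * (- a / z) ^ m * theta q z) has_sum S) UNIV"
    by (rule has_sum_SigmaD[OF S]) (rule rows)
  then have "(\<lambda>m. e_coeff q m * (- a / z) ^ m * theta q z) sums S"
    by (rule has_sum_imp_sums)
  moreover have "(\<lambda>m. e_coeff q m * (- a / z) ^ m * theta q z) sums (1 / qpoch_inf (- a / z) q * theta q z)"
    unfolding e_coeff_suminf[OF q small(2), symmetric]
    by (intro sums_mult2 summable_sums summable_norm_cancel[OF summable_norm_e_coeff] q small)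
  ultimately have S_eq: "S = theta q z / qpoch_inf (- a / z) q"
    using sums_unique2[of _ S] by simp
  have cols: "((\<lambda>m. F (m, n)) has_sum qpoch_inf (a * q powi n) q * theta_term q z n) UNIV" for n
  proof -
    have eq: "F (m, n) = E_coeff q m * (a * q powi n) ^ m * theta_term q z n" for m
    proof -
      \<comment> \<open>The mixed factor \<open>q powi (m * n)\<close> may be read as part of the
        theta argument (rows) or of the Euler argument (columns).\<close>
      have "(q ^ m) powi n = (q powi n) ^ m"
        by (metis mult.commute power_int_mult power_int_of_nat)
      then show ?thesis
        by (simp add: F_def theta_term_def power_int_mult_distrib power_mult_distrib)
    qed
    have "((\<lambda>m. E_coeff q m * (a * q powi n) ^ m) has_sum qpoch_inf (a * q powi n) q) UNIV"
      unfolding qpoch_inf_def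
      by (intro norm_summable_imp_has_sum summable_norm_E_coeff summable_sums summable_E_coeff q)
    from has_sum_cmult_left[OF this, of "theta_term q z n"] show ?thesis
      unfolding eq .
  qed
  have "((\<lambda>(n, m). F (m, n)) has_sum S) (UNIV \<times> UNIV)"
    using S has_sum_swap by blast
  then have "((\<lambda>n. qpoch_inf (a * q powi n) q * theta_term q z n) has_sum S) UNIV"
    by (rule has_sum_SigmaD) (use cols in simp)
  then show ?thesis unfolding S_eq .
qed

end

lemma theta_term_nonzero: "q \<noteq> 0 \<Longrightarrow> z \<noteq> 0 \<Longrightarrow> theta_term q z n \<noteq> 0"
  by (simp add: theta_term_def)

lemma theta_term_0 [simp]: "theta_term q z 0 = 1"
  by (simp add: theta_term_def)

lemma theta_term_mult:
  "theta_term q (w * z) n = w powi n * theta_term q z n"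
  by (simp add: theta_term_def power_int_mult_distrib)

lemma triangular_int_add:
  "(m + n) * (m + n - 1) div 2 = m * (m - 1) div 2 + n * (n - 1) div 2 + m * (n::int)"
proof -
  have "even (k * (k - 1))" for k :: int by simp
  then obtain a b where "m * (m - 1) = 2 * a" "n * (n - 1) = 2 * b"
    by (metis evenE)
  moreover from this have "(m + n) * (m + n - 1) = 2 * (a + b + m * n)"
    by (simp add: algebra_simps)
  ultimately show ?thesis by simp
qed

lemma theta_term_add:
  assumes "q \<noteq> 0" "z \<noteq> 0"
  shows "theta_term q z (m + n) = theta_term q z n * theta_term q (q powi n * z) m"
proof -
  have "q powi (m * n) = (q powi n) powi m"
    by (metis mult.commute power_int_mult)
  then show ?thesis
    unfolding theta_term_mult unfolding theta_term_def triangular_int_add using assms by (simp add: power_int_add)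
qed

section \<open>Bilateral Pochhammer symbols, Jacobi's triple product and the general Laplace
  sum\<close>

lemma qpoch_inf_split_int:
  assumes q: "norm q < 1" "q \<noteq> 0" and "m \<le> n"
  shows "qpoch_inf (b * q powi m) q = (\<Prod>k\<in>{m..<n}. 1 - b * q powi k) * qpoch_inf (b * q powi n) q"
  using \<open>m \<le> n\<close>
proof (induction n rule: int_ge_induct)
  case (step n)
  have "{m..<n + 1} = insert n {m..<n}" using step.hyps by auto
  then show ?case
    using step.IH qpoch_inf_rec[OF q(1), of "b * q powi n"] q
    by (simp add: power_int_add mult_ac)
qed simp

text \<open>Splitting the infinite product between 0 and \<open>n\<close> treats both signs of
  \<open>n\<close>. If a factor of negative index vanishes, both sides are 0, the left one because
  \<open>inverse 0 = 0\<close>.\<close>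

lemma inverse_qpoch:
  assumes q: "norm q < 1" "q \<noteq> 0" and b: "qpoch_inf b q \<noteq> 0"
  shows "1 / qpoch b q n = qpoch_inf (b * q powi n) q / qpoch_inf b q"
proof (cases "n \<ge> 0")
  case True
  then show ?thesis
    using qpoch_inf_split_int[OF q True, of b] b by (auto simp: qpoch_def)
next
  case False
  then have "{n..-1} = {n..<0}" by auto
  then show ?thesis
    using qpoch_inf_split_int[OF q, of n 0 b] b False by (auto simp: qpoch_def divide_inverse)
qed

context
  fixes q :: complex
  assumes q: "norm q < 1" and q0: "q \<noteq> 0"
begin

lemma theta_shift_int:
  assumes z: "z \<noteq> 0"
  shows "theta q (q powi n * z) * theta_term q z n = theta q z"
proof -
  have step: "theta q (q powi (n + 1) * z) * theta_term q z (n + 1) = theta q (q powi n * z) * theta_term q z n" for n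
    using theta_shift[OF q q0, of "q powi n * z"] theta_term_succ[OF q0 z, of n] z q0
    by (simp add: power_int_add mult_ac)
  show ?thesis
  proof (induction n rule: int_induct[where k = 0])
    case (step2 i)
    then show ?case using step[of "i - 1"] by simp
  qed (use step in auto)
qed

text \<open>For \<open>a = q\<close> the negative half of the series vanishes, because
  \<open>qpoch_inf (q * q powi n) q\<close> then contains a zero factor, and the other half is
  Euler's series at \<open>- z\<close>. So the sum exists for every nonzero \<open>z\<close>, while
  \<open>bilateral_sum\<close> covers \<open>norm q < norm z\<close>.\<close>

lemma bilateral_sum_q:
  assumes z: "z \<noteq> 0"
  shows "((\<lambda>n. qpoch_inf (q * q powi n) q * theta_term q z n) has_sum
    qpoch_inf q q * qpoch_inf (- z) q) UNIV"
proof -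
  let ?f = "\<lambda>n. qpoch_inf (q * q powi n) q * theta_term q z n"
  have nat: "?f (int m) = qpoch_inf q q * (E_coeff q m * (- z) ^ m)" for m
  proof (induction m)
    case (Suc m)
    have "q * q powi int (Suc m) = q * q ^ m * q"
      unfolding power_int_of_nat by simp
    then have "?f (int (Suc m)) * (1 - q ^ Suc m) = (1 - q * q ^ m) * qpoch_inf (q * q ^ m * q) q * theta_term q z (int m + 1)"
      using q0 by (simp add: mult_ac add.commute)
    also have "\<dots> = ?f (int m) * (z * q ^ m)"
      unfolding qpoch_inf_rec[OF q, of "q * q ^ m", symmetric] theta_term_succ[OF q0 z] by simp
    also have "\<dots> = qpoch_inf q q * (E_coeff q m * (- z) ^ m) * (z * q ^ m)"
      unfolding Suc.IH ..
    also have "\<dots> = qpoch_inf q q * (E_coeff q (Suc m) * (1 - q ^ Suc m)) * (- z) ^ Suc m"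
      using one_minus_power_nonzero[OF q, of m] by simp
    finally have "?f (int (Suc m)) * (1 - q ^ Suc m) =
      (qpoch_inf q q * (E_coeff q (Suc m) * (- z) ^ Suc m)) * (1 - q ^ Suc m)"
      by (simp only: mult_ac)
    then show ?case
      using one_minus_power_nonzero[OF q, of m] mult_right_cancel by blast
  qed simp
  have neg: "?f n = 0" if "n \<notin> range int" for n
  proof -
    have "n < 0" using that by (metis not_less rangeI zero_le_imp_eq_int)
    \<comment> \<open>The vanishing factor has index \<open>- n - 1\<close>, where the powers of
      \<open>q\<close> multiply to 1.\<close>
    then have "q * q powi n * q ^ nat (- n - 1) = q * q powi n * q powi (- n - 1)"
      by (simp add: power_int_def)
    also have "\<dots> = q * q powi (n + (- n - 1))"
      by (simp only: power_int_add[OF disjI1[OF q0]] mult.assoc)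
    also have "\<dots> = 1" using q0 by simp
    finally have "qpoch_inf (q * q powi n) q = 0"
      using qpoch_inf_nonzero_iff[OF q, of "q * q powi n"] by auto
    then show ?thesis by simp
  qed
  have "((\<lambda>m. E_coeff q m * (- z) ^ m) has_sum qpoch_inf (- z) q) UNIV"
    unfolding qpoch_inf_def
    by (intro norm_summable_imp_has_sum summable_norm_E_coeff summable_sums summable_E_coeff q)
  from has_sum_cmult_right[OF this, of "qpoch_inf q q"]
  have "(?f has_sum qpoch_inf q q * qpoch_inf (- z) q) (range int)"
    unfolding nat[symmetric] by (subst has_sum_reindex) (auto simp: o_def)
  then show ?thesis
    by (rule has_sum_cong_neutral[THEN iffD1, rotated -1]) (use neg in auto)
qed

text \<open>Where \<open>norm q < norm z\<close>, \<open>bilateral_sum\<close> with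
  \<open>a = q\<close> and \<open>bilateral_sum_q\<close> evaluate the same series, and comparing
  them gives the identity. Both sides obey the same equation when \<open>z\<close> becomes
  \<open>q * z\<close>, which transports it to all nonzero \<open>z\<close>.\<close>

lemma jacobi_triple_product:
  assumes z: "z \<noteq> 0"
  shows "theta q z = qpoch_inf q q * qpoch_inf (- z) q * qpoch_inf (- q / z) q"
proof -
  have large: "theta q w = qpoch_inf q q * qpoch_inf (- w) q * qpoch_inf (- q / w) q"
    if w: "w \<noteq> 0" "norm q < norm w" for w
  proof -
    have "norm (- q / w) < 1" using w by (simp add: norm_divide)
    then have "qpoch_inf (- q / w) q \<noteq> 0" by (rule qpoch_inf_nonzero[OF q])
    moreover have "theta q w / qpoch_inf (- q / w) q = qpoch_inf q q * qpoch_inf (- w) q"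
      using has_sum_unique[OF bilateral_sum[OF q q0 w] bilateral_sum_q[OF w(1)]] .
    ultimately show ?thesis by (simp add: field_simps)
  qed
  have "(\<lambda>n. norm q ^ n) \<longlonglongrightarrow> 0"
    using q by (intro LIMSEQ_power_zero) auto
  moreover have "norm z / norm q > 0" using z q0 by simp
  ultimately have "\<forall>\<^sub>F n in sequentially. norm q ^ n < norm z / norm q"
    by (rule order_tendstoD)
  then obtain n where n: "norm q ^ n < norm z / norm q"
    by (auto simp: eventually_sequentially)
  \<comment> \<open>Dividing by a high power of \<open>q\<close> moves \<open>z\<close> into the
    region already treated; the bound on \<open>n\<close> says exactly
    \<open>norm q < norm w\<close>.\<close>
  define w where "w = z / q ^ n"
  have w: "w \<noteq> 0" "norm q < norm w"
    using n q0 z by (auto simp: w_def norm_divide norm_power field_simps)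
  have "theta q (q ^ m * w) = qpoch_inf q q * qpoch_inf (- (q ^ m * w)) q * qpoch_inf (- q / (q ^ m * w)) q" for m
  proof (induction m)
    case 0
    then show ?case using large[OF w] by simp
  next
    case (Suc m)
    define v where "v = q ^ m * w"
    have v: "v \<noteq> 0" using w q0 by (simp add: v_def)
    have "theta q (q * v) = qpoch_inf q q * qpoch_inf (- v) q * qpoch_inf (- q / v) q / v"
      using Suc.IH theta_shift[OF q q0 v] by (simp add: v_def)
    also have "qpoch_inf (- v) q = (1 + v) * qpoch_inf (- (q * v)) q"
      using qpoch_inf_rec[OF q, of "- v"] by (simp add: mult_ac)
    also have "qpoch_inf q q * ((1 + v) * qpoch_inf (- (q * v)) q) * qpoch_inf (- q / v) q / v
        = qpoch_inf q q * qpoch_inf (- (q * v)) q * ((1 + 1 / v) * qpoch_inf (- q / v) q)"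
      using v by (simp add: field_simps)
    also have "(1 + 1 / v) * qpoch_inf (- q / v) q = qpoch_inf (- q / (q * v)) q"
      using qpoch_inf_rec[OF q, of "- 1 / v"] q0 by simp
    finally show ?case by (simp add: v_def mult.assoc)
  qed
  from this[of n] show ?thesis using q0 by (simp add: w_def)
qed

lemma theta_analytic: "theta q analytic_on - {0}"
proof -
  have "(\<lambda>z. qpoch_inf q q * qpoch_inf (- z) q * qpoch_inf (- q / z) q) analytic_on - {0}"
    by (intro analytic_intros q) auto
  then have "(\<lambda>z. qpoch_inf q q * qpoch_inf (- z) q * qpoch_inf (- q / z) q) holomorphic_on - {0}"
    by (rule analytic_imp_holomorphic)
  then have "theta q holomorphic_on - {0}"
    by (rule holomorphic_transform) (auto simp: jacobi_triple_product)
  moreover have "open (- {0 :: complex})" by auto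
  ultimately show ?thesis using analytic_on_open by blast
qed

text \<open>Along the spiral \<open>lam * q powi n\<close> the theta denominator is
  \<open>theta q (lam / X)\<close> divided by \<open>theta_term q (lam / X) n\<close>, so the
  Laplace sum is the series of \<open>bilateral_sum\<close> with \<open>a = - q * lam / b\<close>
  and \<open>z = q * lam / (b * X)\<close>. Then \<open>- a / z = X\<close>, and the convergence
  condition reads \<open>norm X < 1\<close>.\<close>

lemma q_Laplace_eq:
  assumes nz: "lam \<noteq> 0" "X \<noteq> 0" "b \<noteq> 0" and X: "norm X < 1"
    and psi: "\<And>n. \<psi> (lam * q powi n) = A * (q / b) powi n * qpoch_inf (- q * lam / b * q powi n) q"
  shows "q_Laplace q lam \<psi> X = A * theta q (q * lam / (b * X)) / (theta q (lam / X) * qpoch_inf X q)"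
proof -
  define z where "z = q * lam / (b * X)"
  have z: "z \<noteq> 0" using nz q0 by (simp add: z_def)
  have "norm (- q * lam / b) = norm z * norm X"
    using nz by (simp add: z_def norm_mult norm_divide)
  also have "\<dots> < norm z * 1"
    using z X by (intro mult_strict_left_mono) auto
  finally have "norm (- q * lam / b) < norm z" by simp
  then have "((\<lambda>n. qpoch_inf (- q * lam / b * q powi n) q * theta_term q z n) has_sum
      theta q z / qpoch_inf (- (- q * lam / b) / z) q) UNIV"
    by (rule bilateral_sum[OF q q0 z])
  also have "- (- q * lam / b) / z = X"
    using nz q0 by (simp add: z_def)
  finally have "((\<lambda>n. A / theta q (lam / X) * (qpoch_inf (- q * lam / b * q powi n) q * theta_term q z n)) has_sum
      A / theta q (lam / X) * (theta q z / qpoch_inf X q)) UNIV"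
    by (rule has_sum_cmult_right)
  moreover have "A / theta q (lam / X) * (qpoch_inf (- q * lam / b * q powi n) q * theta_term q z n) =
      \<psi> (lam * q powi n) / theta q (lam * q powi n / X)" for n
  proof -
    have lX: "lam / X \<noteq> 0" using nz by simp
    have "z = q / b * (lam / X)" by (simp add: z_def)
    then have "theta_term q z n = (q / b) powi n * theta_term q (lam / X) n"
      by (simp only: theta_term_mult)
    moreover have "theta q (lam / X) = theta q (lam * q powi n / X) * theta_term q (lam / X) n"
      using theta_shift_int[OF lX, of n] by (simp add: mult_ac)
    ultimately show ?thesis
      unfolding psi using theta_term_nonzero[OF q0 lX, of n] by simp
  qed
  ultimately show ?thesis
    unfolding q_Laplace_def z_def[symmetric] by (intro infsumI) simp
qed

end

section \<open>Borel and Laplace transforms\<close>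

lemma summable_on_int_LIMSEQ:
  fixes f :: "int \<Rightarrow> complex"
  assumes "f summable_on UNIV"
  shows "(\<lambda>m. f (- int m)) \<longlonglongrightarrow> 0"
proof -
  have "f summable_on range (\<lambda>m. - int m)"
    using assms by (rule summable_on_subset_banach) auto
  then have "(\<lambda>m. f (- int m)) summable_on UNIV"
    by (subst (asm) summable_on_reindex) (auto simp: inj_def o_def)
  then show ?thesis
    by (intro summable_LIMSEQ_zero summable_on_imp_summable)
qed

context
  fixes q :: complex
  assumes q: "norm q < 1" and q0: "q \<noteq> 0"
begin

lemma borel_coefficient:
  assumes "qpoch_inf b q \<noteq> 0"
  shows "one_psi_one 0 b q n * q powi (n * (n - 1) div 2) * z powi n =
    qpoch_inf (b * q powi n) q * theta_term q z n / qpoch_inf b q"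
  by (simp add: one_psi_one_0 inverse_qpoch[OF q q0 assms] theta_term_def)

text \<open>\<open>continues_bilateral\<close> prescribes a value wherever the series converges, so
  convergence in the disc has to be excluded. The triple product at
  \<open>- b * q powi (- m)\<close> shows that the term of index \<open>- m\<close>, times a factor
  tending to 1, is a nonzero constant times \<open>(- b / z) ^ m\<close>, which does not tend to
  0.\<close>

lemma borel_terms_not_summable:
  assumes b: "b \<noteq> 0" "qpoch_inf b q \<noteq> 0" "qpoch_inf (q / b) q \<noteq> 0"
    and z: "z \<noteq> 0" "norm z \<le> norm b"
  shows "\<not> (\<lambda>n. qpoch_inf (b * q powi n) q * theta_term q z n) summable_on UNIV"
proof
  assume "(\<lambda>n. qpoch_inf (b * q powi n) q * theta_term q z n) summable_on UNIV"
  from summable_on_int_LIMSEQ[OF this]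
  have lim0: "(\<lambda>m. qpoch_inf (b * q powi (- int m)) q * theta_term q z (- int m)) \<longlonglongrightarrow> 0" .
  let ?w = "- b"
  have w: "?w \<noteq> 0" using b by simp
  have E: "qpoch_inf (b * q powi (- int m)) q * theta_term q z (- int m) * qpoch_inf (q / b * q ^ m) q
      = qpoch_inf b q * qpoch_inf (q / b) q * (- b / z) ^ m" for m
  proof -
    let ?n = "- int m"
    have "theta q (q powi ?n * ?w) = qpoch_inf q q * qpoch_inf (b * q powi ?n) q * qpoch_inf (q / b * q ^ m) q"
      using jacobi_triple_product[OF q q0, of "q powi ?n * ?w"] w q0
      by (simp add: power_int_minus field_simps)
    moreover have "theta q ?w = qpoch_inf q q * qpoch_inf b q * qpoch_inf (q / b) q"
      using jacobi_triple_product[OF q q0, of "?w"] w by simp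
    ultimately have "qpoch_inf q q * (qpoch_inf (b * q powi ?n) q * qpoch_inf (q / b * q ^ m) q * theta_term q ?w ?n)
       = qpoch_inf q q * (qpoch_inf b q * qpoch_inf (q / b) q)"
      using theta_shift_int[OF q q0 w, of ?n] by (simp add: mult_ac)
    then have *: "qpoch_inf (b * q powi ?n) q * qpoch_inf (q / b * q ^ m) q * theta_term q ?w ?n
       = qpoch_inf b q * qpoch_inf (q / b) q"
      using qpoch_inf_nonzero[OF q q] by simp
    have "z = (z / ?w) * ?w" using b by simp
    then have "theta_term q z ?n = (z / ?w) powi ?n * theta_term q ?w ?n"
      by (metis theta_term_mult)
    also have "(z / ?w) powi ?n = (- b / z) ^ m"
    proof -
      have "inverse (z / ?w) = - b / z" by simp
      then show ?thesis
        by (simp only: power_int_minus power_int_of_nat power_inverse[symmetric])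
    qed
    finally show ?thesis
      unfolding *[symmetric] by (simp only: mult_ac)
  qed
  have "(\<lambda>m. qpoch_inf (b * q powi (- int m)) q * theta_term q z (- int m) * qpoch_inf (q / b * q ^ m) q) \<longlonglongrightarrow> 0 * 1"
    by (intro tendsto_mult lim0 qpoch_inf_shift_tendsto q)
  then have "(\<lambda>m. norm (qpoch_inf b q * qpoch_inf (q / b) q * (- b / z) ^ m)) \<longlonglongrightarrow> 0"
    unfolding E using tendsto_norm_zero by fastforce
  moreover have "norm (qpoch_inf b q * qpoch_inf (q / b) q) \<le> norm (qpoch_inf b q * qpoch_inf (q / b) q * (- b / z) ^ m)" for m
  proof -
    have "1 \<le> norm (- b / z) ^ m"
      using z by (intro one_le_power) (simp add: norm_divide)
    from mult_left_mono[OF this norm_ge_zero] show ?thesis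
      unfolding norm_mult[of _ "(- b / z) ^ m"] norm_power by simp
  qed
  ultimately have "norm (qpoch_inf b q * qpoch_inf (q / b) q) \<le> 0"
    by (intro LIMSEQ_le_const) auto
  then show False using b by simp
qed

text \<open>The continuation is chosen by \<open>SOME\<close>, so it is pinned down by exhibiting
  one, \<open>remove_sings g\<close>, and applying \<open>continues_bilateral_unique\<close> on the
  exterior \<open>norm b < norm z\<close>, where the series sums to \<open>g\<close>. Where the
  denominator is nonzero, \<open>remove_sings g\<close> agrees with \<open>g\<close>.\<close>

lemma q_Borel_generic:
  assumes b: "b \<noteq> 0" "qpoch_inf b q \<noteq> 0" "qpoch_inf (q / b) q \<noteq> 0"
    and z: "z \<noteq> 0" "qpoch_inf (- b / z) q \<noteq> 0"
  shows "q_Borel q (one_psi_one 0 b q) z = theta q z / (qpoch_inf b q * qpoch_inf (- b / z) q)"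
proof -
  define g where "g = (\<lambda>z. theta q z / (qpoch_inf b q * qpoch_inf (- b / z) q))"
  let ?c = "\<lambda>n. one_psi_one 0 b q n * q powi (n * (n - 1) div 2)"
  have "theta q analytic_on - {0}" "(\<lambda>z. qpoch_inf b q * qpoch_inf (- b / z) q) analytic_on - {0}"
    using theta_analytic[OF q q0] by (auto intro!: analytic_intros q)
  then have mero: "g meromorphic_on - {0}"
    unfolding g_def by (intro meromorphic_on_divide analytic_on_imp_meromorphic_on)
  have ana: "g analytic_on {z}" if "z \<noteq> 0" "qpoch_inf (- b / z) q \<noteq> 0" for z
    unfolding g_def using that b
    by (intro analytic_intros q analytic_on_subset[OF theta_analytic[OF q q0]]) auto
  have S: "((\<lambda>n. ?c n * z powi n) has_sum g z) UNIV" if z: "z \<noteq> 0" "norm b < norm z" for z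
    using has_sum_cmult_left[OF bilateral_sum[OF q q0 z], of "1 / qpoch_inf b q"]
    unfolding borel_coefficient[OF b(2)] g_def by (simp add: mult_ac)
  have large: "norm (- b / z) < 1" if "norm b < norm z" for z
    using that by (auto simp: norm_divide divide_less_eq_1)
  \<comment> \<open>\<open>remove_sings\<close> fills removable singularities and installs the value
    0 at poles, as \<open>nicely_meromorphic_on\<close> demands.\<close>
  have cont: "continues_bilateral (remove_sings g) ?c"
    unfolding continues_bilateral_def
  proof (intro conjI allI impI)
    show "remove_sings g nicely_meromorphic_on - {0}"
      by (rule remove_sings_nicely_meromorphic[OF mero])
    fix z :: complex
    assume z: "z \<noteq> 0" and "(\<lambda>n. ?c n * z powi n) summable_on UNIV"
    then have "(\<lambda>n. qpoch_inf (b * q powi n) q * theta_term q z n) summable_on UNIV"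
      unfolding borel_coefficient[OF b(2)] using b(2)
      by (simp add: divide_inverse summable_on_cmult_left')
    then have *: "norm b < norm z"
      using borel_terms_not_summable[OF b z] by force
    then have "remove_sings g z = g z"
      by (intro remove_sings_at_analytic ana z qpoch_inf_nonzero q large)
    then show "remove_sings g z = (\<Sum>\<^sub>\<infinity>n. ?c n * z powi n)"
      using infsumI[OF S[OF z *]] by simp
  qed
  have "continues_bilateral (q_Borel q (one_psi_one 0 b q)) ?c"
    unfolding q_Borel_def by (rule someI[of _ "remove_sings g"]) (rule cont)
  then have "q_Borel q (one_psi_one 0 b q) z = remove_sings g z"
  proof (rule continues_bilateral_unique[OF _ cont])
    show "open {z. norm b < norm z}"
      by (intro open_Collect_less continuous_intros)
    show "{z::complex. norm b < norm z} \<noteq> {}"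
      by (rule ex_in_conv[THEN iffD1], rule exI[of _ "of_real (norm b + 1)"]) auto
    show "(\<lambda>n. ?c n * \<xi> powi n) summable_on UNIV" if "\<xi> \<in> {z. norm b < norm z}" for \<xi>
    proof -
      have "\<xi> \<noteq> 0" "norm b < norm \<xi>" using that by auto
      then show ?thesis using S has_sum_imp_summable by blast
    qed
  qed (use z in auto)
  also have "\<dots> = g z"
    by (intro remove_sings_at_analytic ana z)
  finally show ?thesis by (simp add: g_def)
qed

text \<open>Here \<open>b\<close> is a positive power of \<open>q\<close>, so the series terminates
  to the left and converges everywhere; the convergence clause of \<open>continues_bilateral\<close>
  then fixes the value. The sum is \<open>bilateral_sum_q\<close> with its index shifted by
  \<open>N\<close>.\<close>

lemma q_Borel_integer:
  fixes N :: int
  assumes N: "N \<le> 0" and z: "z \<noteq> 0"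
  defines "b \<equiv> q powi (1 - N)"
  shows "q_Borel q (one_psi_one 0 b q) z =
    qpoch_inf q q / qpoch_inf b q * theta_term q z N * qpoch_inf (- (q powi N * z)) q"
proof -
  define g where "g = (\<lambda>z. qpoch_inf q q / qpoch_inf b q * theta_term q z N * qpoch_inf (- (q powi N * z)) q)"
  let ?c = "\<lambda>n. one_psi_one 0 b q n * q powi (n * (n - 1) div 2)"
  have "norm q powi (1 - N) = norm q ^ nat (1 - N)"
    using N by (simp add: power_int_def)
  also have "\<dots> < 1" using q N by (intro power_less_one_iff[THEN iffD2]) auto
  finally have b: "qpoch_inf b q \<noteq> 0"
    unfolding b_def by (intro qpoch_inf_nonzero q) (simp add: norm_power_int)
  have S: "((\<lambda>n. ?c n * z powi n) has_sum g z) UNIV" if z: "z \<noteq> 0" for z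
  proof -
    have bij: "bij_betw (\<lambda>m::int. m + N) UNIV UNIV"
      by (rule bij_betwI[of _ _ _ "\<lambda>n. n - N"]) auto
    have "q powi N * z \<noteq> 0" using q0 z by simp
    from has_sum_cmult_right[OF bilateral_sum_q[OF q q0 this], of "theta_term q z N / qpoch_inf b q"]
    have "((\<lambda>m. theta_term q z N / qpoch_inf b q * (qpoch_inf (q * q powi m) q * theta_term q (q powi N * z) m)) has_sum g z) UNIV"
      by (simp add: g_def mult_ac)
    also have "(\<lambda>m. theta_term q z N / qpoch_inf b q * (qpoch_inf (q * q powi m) q * theta_term q (q powi N * z) m))
        = (\<lambda>m. ?c (m + N) * z powi (m + N))"
    proof
      fix m
      \<comment> \<open>The shift by \<open>N\<close> turns \<open>b\<close> into \<open>q\<close>,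
        the case in which the negative half of the series drops out.\<close>
      have "b * q powi (m + N) = q * q powi m"
        using q0 unfolding b_def power_int_add[OF disjI1[OF q0], symmetric] by (simp add: power_int_add)
      then show "theta_term q z N / qpoch_inf b q * (qpoch_inf (q * q powi m) q * theta_term q (q powi N * z) m)
        = ?c (m + N) * z powi (m + N)"
        unfolding borel_coefficient[OF b] theta_term_add[OF q0 z] by simp
    qed
    finally show ?thesis
      by (subst (asm) has_sum_reindex_bij_betw[OF bij, where f = "\<lambda>n. ?c n * z powi n"])
  qed
  have "(\<lambda>z::complex. z powi N) analytic_on - {0}"
    by (intro analytic_intros) auto
  then have "g analytic_on - {0}"
    unfolding g_def theta_term_def by (intro analytic_intros q) auto
  then have "continues_bilateral g ?c"
    unfolding continues_bilateral_def
    using infsumI[OF S] analytic_on_imp_nicely_meromorphic_on by auto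
  then have "continues_bilateral (q_Borel q (one_psi_one 0 b q)) ?c"
    unfolding q_Borel_def by (rule someI[of _ g])
  then have "q_Borel q (one_psi_one 0 b q) z = (\<Sum>\<^sub>\<infinity>n. ?c n * z powi n)"
    unfolding continues_bilateral_def using z has_sum_imp_summable[OF S[OF z]] by blast
  then show ?thesis
    using infsumI[OF S[OF z]] by (simp add: g_def)
qed

text \<open>By the triple product at \<open>q powi n * w\<close>, the reciprocal product in the
  Borel transform becomes \<open>qpoch_inf (- q * lam / b * q powi n) q\<close> over a theta value,
  and quasi-periodicity leaves a geometric factor: the form required by \<open>q_Laplace_eq\<close>.
  The hypothesis on \<open>theta q (q / b * lam)\<close> keeps the spiral off the zeros of the
  denominator.\<close>

lemma q_Laplace_Borel_generic:
  assumes nz: "lam \<noteq> 0" "X \<noteq> 0" and X: "norm X < 1"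
    and b: "b \<noteq> 0" "qpoch_inf b q \<noteq> 0" "qpoch_inf (q / b) q \<noteq> 0"
    and t: "theta q (q / b * lam) \<noteq> 0"
  shows "q_Laplace q lam (q_Borel q (one_psi_one 0 b q)) X =
    qpoch_inf q q / qpoch_inf b q / qpoch_inf X q * (theta q lam / theta q (q / b * lam))
      * (theta q (q / b * (lam / X)) / theta q (lam / X))"
proof -
  define w where "w = q / b * lam"
  have w: "w \<noteq> 0" using nz b q0 by (simp add: w_def)
  have psi: "q_Borel q (one_psi_one 0 b q) (lam * q powi n) =
      (qpoch_inf q q / qpoch_inf b q * theta q lam / theta q w) * (q / b) powi n * qpoch_inf (- q * lam / b * q powi n) q" for n
  proof -
    have qn: "q powi n * w \<noteq> 0" "lam * q powi n \<noteq> 0" using w q0 nz by auto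
    have J: "theta q (q powi n * w) = qpoch_inf q q * qpoch_inf (- q * lam / b * q powi n) q * qpoch_inf (- b / (lam * q powi n)) q"
      using jacobi_triple_product[OF q q0 qn(1)] nz q0 b by (simp add: w_def field_simps)
    have sw: "theta q (q powi n * w) * theta_term q w n = theta q w"
      by (rule theta_shift_int[OF q q0 w])
    have sl: "theta q (lam * q powi n) * theta_term q lam n = theta q lam"
      using theta_shift_int[OF q q0 nz(1), of n] by (simp add: mult_ac)
    have tw: "theta_term q w n = (q / b) powi n * theta_term q lam n"
      unfolding w_def by (rule theta_term_mult)
    have n0: "theta q (q powi n * w) \<noteq> 0" using sw t by (auto simp: w_def)
    then have E: "qpoch_inf (- b / (lam * q powi n)) q \<noteq> 0" unfolding J by auto
    have tl: "theta_term q lam n \<noteq> 0" using theta_term_nonzero[OF q0 nz(1)] .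
    have "theta q (lam * q powi n) / qpoch_inf (- b / (lam * q powi n)) q =
        qpoch_inf q q * qpoch_inf (- q * lam / b * q powi n) q * theta q (lam * q powi n) / theta q (q powi n * w)"
      using E n0 unfolding J by (auto simp: divide_simps)
    also have "\<dots> = qpoch_inf q q * qpoch_inf (- q * lam / b * q powi n) q * theta q lam * (q / b) powi n / theta q w"
      unfolding sw[symmetric] sl[symmetric] tw using n0 tl b q0 by (simp add: divide_simps)
    finally have *: "theta q (lam * q powi n) / qpoch_inf (- b / (lam * q powi n)) q =
        qpoch_inf q q * qpoch_inf (- q * lam / b * q powi n) q * theta q lam * (q / b) powi n / theta q w" .
    have "q_Borel q (one_psi_one 0 b q) (lam * q powi n) =
        theta q (lam * q powi n) / qpoch_inf (- b / (lam * q powi n)) q / qpoch_inf b q"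
      unfolding q_Borel_generic[OF b qn(2) E] by (simp only: divide_divide_eq_left mult.commute)
    then show ?thesis
      unfolding * by (simp add: mult_ac)
  qed
  show ?thesis
    using q_Laplace_eq[OF q q0 nz b(1) X psi] by (simp add: w_def mult_ac)
qed

text \<open>Since \<open>q / b = q powi N\<close>, the remaining theta quotient is a
  quasi-periodicity factor, and it combines with \<open>theta_term q lam N\<close> to the monomial
  \<open>X powi N\<close>.\<close>

lemma q_Laplace_Borel_integer:
  fixes N :: int
  assumes nz: "lam \<noteq> 0" "X \<noteq> 0" and X: "norm X < 1"
    and N: "N \<le> 0" and t: "theta q (lam / X) \<noteq> 0"
  shows "q_Laplace q lam (q_Borel q (one_psi_one 0 (q powi (1 - N)) q)) X =
    qpoch_inf q q / qpoch_inf (q powi (1 - N)) q / qpoch_inf X q * X powi N"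
proof -
  define b where "b = q powi (1 - N)"
  have b: "b \<noteq> 0" using q0 by (simp add: b_def)
  have qb: "q / b = q powi N"
    using q0 by (simp add: b_def power_int_diff)
  have lX: "lam / X \<noteq> 0" using nz by simp
  have psi: "q_Borel q (one_psi_one 0 b q) (lam * q powi n) =
      (qpoch_inf q q / qpoch_inf b q * theta_term q lam N) * (q / b) powi n * qpoch_inf (- q * lam / b * q powi n) q" for n
  proof -
    have "lam * q powi n \<noteq> 0" using nz q0 by simp
    moreover have "theta_term q (lam * q powi n) N = (q / b) powi n * theta_term q lam N"
      unfolding qb mult.commute[of lam] theta_term_mult
      by (metis mult.commute power_int_mult)
    moreover have "- (q powi N * (lam * q powi n)) = - q * lam / b * q powi n"
      unfolding qb[symmetric] by simp
    ultimately show ?thesis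
      using q_Borel_integer[OF N \<open>lam * q powi n \<noteq> 0\<close>] unfolding b_def[symmetric] by (simp only: mult_ac)
  qed
  have "theta q (q * lam / (b * X)) * theta_term q (lam / X) N = theta q (lam / X)"
    using theta_shift_int[OF q q0 lX, of N] unfolding qb[symmetric] by simp
  then have "theta q (q * lam / (b * X)) / theta q (lam / X) = 1 / theta_term q (lam / X) N"
    using t theta_term_nonzero[OF q0 lX, of N] by (simp add: field_simps)
  moreover have "theta_term q lam N = X powi N * theta_term q (lam / X) N"
    using theta_term_mult[of q X "lam / X" N] nz by simp
  ultimately show ?thesis
    using q_Laplace_eq[OF q q0 nz b X psi] theta_term_nonzero[OF q0 lX, of N]
    unfolding b_def[symmetric] by (simp add: field_simps)
qed

end

section \<open>Telescoping second differences\<close>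

lemma norm_exp_minus_one_le:
  fixes z :: complex
  assumes "norm z \<le> 1"
  shows "norm (exp z - 1) \<le> 3 * norm z"
proof -
  \<comment> \<open>The constant 3 bounds the derivative, which is at most \<open>exp 1\<close> in
    norm on the unit disc.\<close>
  have "norm (exp z - exp 0) \<le> 3 * norm (z - 0)"
  proof (rule field_differentiable_bound[of "cball 0 1"])
    fix w :: complex assume "w \<in> cball 0 1"
    then have "exp (norm w) \<le> exp 1" by simp
    moreover have "norm (exp w) \<le> exp (norm w)" by (rule norm_exp)
    ultimately show "norm (exp w) \<le> 3" using exp_le by linarith
  qed (use assms in \<open>auto intro!: derivative_eq_intros\<close>)
  then show ?thesis by simp
qed

text \<open>Expand \<open>f\<close> to first order at \<open>a\<close> for both increments. The
  linear term \<open>s * d * f' a\<close> cancels, leaving two quadratic remainders: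
  \<open>norm s ^ 2\<close> comes from the increment \<open>s * d\<close>, and \<open>norm s\<close>
  from the increment \<open>d\<close>.\<close>

lemma second_difference_bound:
  fixes f :: "complex \<Rightarrow> complex"
  assumes S: "convex S"
    and f: "\<And>z. z \<in> S \<Longrightarrow> (f has_field_derivative f' z) (at z)"
    and f': "\<And>z. z \<in> S \<Longrightarrow> (f' has_field_derivative f'' z) (at z)"
    and M: "\<And>z. z \<in> S \<Longrightarrow> norm (f'' z) \<le> M"
    and a: "a \<in> S" "a + d \<in> S" "a + s * d \<in> S"
  shows "norm (f (a + s * d) - f a - s * (f (a + d) - f a)) \<le> (norm s ^ 2 + norm s) * norm d ^ 2 * M"
proof -
  define g where "g = (\<lambda>i::nat. if i = 0 then f else if i = 1 then f' else f'')"
  have T: "norm (f z - (f a + f' a * (z - a))) \<le> M * norm (z - a) ^ 2" if "z \<in> S" for z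
  proof -
    have "(g i has_field_derivative g (Suc i) w) (at w within S)" if "w \<in> S" "i \<le> 1" for i w
      using that f f' by (cases i) (auto simp: g_def intro: has_field_derivative_at_within)
    moreover have "norm (g (Suc 1) w) \<le> M" if "w \<in> S" for w
      using M that by (simp add: g_def)
    ultimately have "norm (g 0 z - (\<Sum>i\<le>1. g i a * (z - a) ^ i / fact i)) \<le> M * norm (z - a) ^ Suc 1 / fact 1"
      using a(1) that by (intro complex_Taylor[OF S]) auto
    then show ?thesis by (simp add: g_def numeral_2_eq_2)
  qed
  have "f (a + s * d) - f a - s * (f (a + d) - f a) =
      (f (a + s * d) - (f a + f' a * (a + s * d - a))) - s * (f (a + d) - (f a + f' a * (a + d - a)))"
    by (simp add: algebra_simps)
  also have "norm \<dots> \<le> M * norm (a + s * d - a) ^ 2 + norm s * (M * norm (a + d - a) ^ 2)"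
    by (intro order.trans[OF norm_triangle_ineq4] add_mono T a)
      (unfold norm_mult, intro mult_left_mono T a norm_ge_zero)
  also have "\<dots> = (norm s ^ 2 + norm s) * norm d ^ 2 * M"
    by (simp add: norm_mult power_mult_distrib algebra_simps)
  finally show ?thesis .
qed

lemma sum_minus_telescope_bound:
  fixes p g :: "nat \<Rightarrow> complex"
  assumes "\<And>k. k < n \<Longrightarrow> norm (g k - s * (p (Suc k) - p k)) \<le> B k"
  shows "norm ((\<Sum>k<n. g k) - s * (p n - p 0)) \<le> (\<Sum>k<n. B k)"
proof -
  have "(\<Sum>k<n. g k) - s * (p n - p 0) = (\<Sum>k<n. g k - s * (p (Suc k) - p k))"
    by (simp add: sum_subtractf flip: sum_distrib_left sum_lessThan_telescope)
  also have "norm \<dots> \<le> (\<Sum>k<n. B k)"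
    using assms by (intro sum_norm_le) auto
  finally show ?thesis .
qed

section \<open>The logarithm of \<open>1 + exp v\<close> on the strip
  \<open>\<bar>Im v\<bar> < pi\<close>\<close>

definition softplus :: "complex \<Rightarrow> complex" where
  "softplus v = Ln (1 + exp v)"

lemma one_plus_exp_notin_nonpos_Reals:
  assumes "\<bar>Im v\<bar> < pi"
  shows "1 + exp v \<notin> \<real>\<^sub>\<le>\<^sub>0"
proof
  assume *: "1 + exp v \<in> \<real>\<^sub>\<le>\<^sub>0"
  then have "Im (exp v) = 0" "Re (exp v) < 0"
    by (auto simp: complex_nonpos_Reals_iff)
  then have "sin (Im v) = 0" "cos (Im v) < 0"
    by (auto simp: Im_exp Re_exp mult_less_0_iff)
  moreover from this have "Im v = 0"
    using assms sin_eq_0_pi by auto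
  ultimately show False by simp
qed

lemma one_plus_exp_nonzero: "\<bar>Im v\<bar> < pi \<Longrightarrow> 1 + exp v \<noteq> 0"
  using one_plus_exp_notin_nonpos_Reals by fastforce

lemma exp_softplus: "\<bar>Im v\<bar> < pi \<Longrightarrow> exp (softplus v) = 1 + exp v"
  using one_plus_exp_nonzero by (simp add: softplus_def)

lemma softplus_derivatives:
  assumes "\<bar>Im v\<bar> < pi"
  shows "(softplus has_field_derivative exp v / (1 + exp v)) (at v)"
    and "((\<lambda>v. exp v / (1 + exp v)) has_field_derivative exp v / (1 + exp v) ^ 2) (at v)"
proof -
  show "(softplus has_field_derivative exp v / (1 + exp v)) (at v)"
    unfolding softplus_def[abs_def]
    using one_plus_exp_notin_nonpos_Reals[OF assms] one_plus_exp_nonzero[OF assms]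
    by (auto intro!: derivative_eq_intros simp: field_simps)
  show "((\<lambda>v. exp v / (1 + exp v)) has_field_derivative exp v / (1 + exp v) ^ 2) (at v)"
    using one_plus_exp_nonzero[OF assms]
    by (auto intro!: derivative_eq_intros simp: field_simps power2_eq_square)
qed

text \<open>With \<open>r = exp (Re v)\<close>, the squared norm is at least
  \<open>1 + 2 * r * cos \<phi> + r ^ 2\<close> because the cosine decreases on [0, pi]; completing
  the square there leaves \<open>sin \<phi> ^ 2\<close>.\<close>

lemma norm_one_plus_exp_ge:
  assumes "\<bar>Im v\<bar> \<le> \<phi>" "0 < \<phi>" "\<phi> < pi"
  shows "sin \<phi> \<le> norm (1 + exp v)"
proof (rule power2_le_imp_le)
  let ?r = "exp (Re v)"
  have "cos \<phi> \<le> cos \<bar>Im v\<bar>"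
    using assms by (intro cos_monotone_0_pi_le) auto
  then have c: "cos \<phi> \<le> cos (Im v)" by simp
  have "(sin \<phi>)\<^sup>2 \<le> (?r + cos \<phi>)\<^sup>2 + (sin \<phi>)\<^sup>2" by simp
  also have "\<dots> = 1 + 2 * (?r * cos \<phi>) + ?r\<^sup>2"
    using sin_cos_squared_add[of \<phi>] by (simp add: power2_sum algebra_simps)
  also have "\<dots> \<le> 1 + 2 * (?r * cos (Im v)) + ?r\<^sup>2"
    using c by (intro add_mono mult_left_mono) auto
  also have "\<dots> = (norm (1 + exp v))\<^sup>2"
    unfolding cmod_power2
    by (simp add: Re_exp Im_exp power2_sum power_mult_distrib sin_squared_eq algebra_simps)
  finally show "(sin \<phi>)\<^sup>2 \<le> (norm (1 + exp v))\<^sup>2" .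
qed simp

text \<open>The identity \<open>1 + exp w = exp w * (1 + exp (- w))\<close> in logarithmic form. The
  defect has derivative 0 on the convex strip and vanishes at 0, so no multiple of
  \<open>2 * pi * \<i>\<close> intervenes.\<close>

lemma softplus_reflect:
  assumes "\<bar>Im w\<bar> < pi"
  shows "softplus w - softplus (- w) = w"
proof -
  let ?S = "{v. \<bar>Im v\<bar> < pi}"
  have S: "convex ?S"
  proof -
    have "?S = {v. Im v < pi} \<inter> {v. Im v > - pi}" by auto
    then show ?thesis by (simp add: convex_Int convex_halfspace_Im_lt convex_halfspace_Im_gt)
  qed
  have D: "((\<lambda>v. softplus v - softplus (- v) - v) has_field_derivative 0) (at v within ?S)" if v: "v \<in> ?S" for v
  proof -
    have "((\<lambda>v. softplus (- v)) has_field_derivative exp (- v) / (1 + exp (- v)) * (- 1)) (at v)"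
      by (rule DERIV_chain2[where f = softplus])
        (use v in \<open>auto intro!: softplus_derivatives derivative_eq_intros\<close>)
    then have "((\<lambda>v. softplus v - softplus (- v) - v) has_field_derivative
        (exp v / (1 + exp v) - exp (- v) / (1 + exp (- v)) * (- 1) - 1)) (at v)"
      using v by (intro DERIV_diff softplus_derivatives DERIV_ident) auto
    moreover have "exp v / (1 + exp v) - exp (- v) / (1 + exp (- v)) * (- 1) - 1 = 0"
      using one_plus_exp_nonzero[of v] v by (simp add: exp_minus field_simps)
    ultimately show ?thesis by (simp add: has_field_derivative_at_within)
  qed
  obtain c where c: "\<And>v. v \<in> ?S \<Longrightarrow> softplus v - softplus (- v) - v = c"
    using has_field_derivative_zero_constant[OF S D] by auto
  from c[of 0] c[of w] assms show ?thesis by auto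
qed

section \<open>The limit of theta quotients\<close>

lemma one_minus_exp_minus_ge:
  assumes "0 < h" "h \<le> (1::real)"
  shows "h / 2 \<le> 1 - exp (- h)"
proof -
  have "exp (- h) \<le> 1 / (1 + h)"
    using exp_ge_add_one_self[of h] assms by (simp add: exp_minus field_simps)
  moreover have "h / 2 \<le> h / (1 + h)"
    using assms by (intro divide_left_mono) auto
  moreover have "h / (1 + h) = 1 - 1 / (1 + h)" using assms by (simp add: field_simps)
  ultimately show ?thesis by linarith
qed

lemma softplus_shift_tendsto:
  assumes "h > 0"
  shows "(\<lambda>n. softplus (a - of_nat n * of_real h)) \<longlonglongrightarrow> 0"
proof -
  have "norm (exp (- of_real h :: complex)) < 1"
    using assms by simp
  then have "(\<lambda>n. exp a * exp (- of_real h) ^ n) \<longlonglongrightarrow> exp a * 0"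
    by (intro tendsto_intros LIMSEQ_power_zero)
  then have "(\<lambda>n. exp (a - of_nat n * of_real h)) \<longlonglongrightarrow> 0"
    by (simp add: exp_diff exp_minus field_simps flip: exp_of_nat_mult)
  then have "(\<lambda>n. Ln (1 + exp (a - of_nat n * of_real h))) \<longlonglongrightarrow> Ln (1 + 0)"
    by (intro tendsto_intros) auto
  then show ?thesis by (simp add: softplus_def)
qed

text \<open>With step \<open>- h\<close>, each second difference is of order \<open>h ^ 2\<close>,
  and the second derivative of \<open>softplus\<close> decays like \<open>exp (- k * h)\<close> to
  the left. Summing the geometric series costs only a factor \<open>2 / h\<close>, so the total
  error is of order \<open>h\<close>, uniformly in \<open>n\<close>.\<close>

lemma softplus_sum_bound:
  fixes a s :: complex and h \<phi> :: real
  assumes phi: "0 < \<phi>" "\<phi> < pi" and h: "0 < h" "h \<le> 1"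
    and a: "\<bar>Im a\<bar> + h * norm s \<le> \<phi>" "Re a \<le> 1"
  shows "norm ((\<Sum>k<n. softplus (a - of_nat k * of_real h - s * of_real h) - softplus (a - of_nat k * of_real h))
      - s * (softplus (a - of_nat n * of_real h) - softplus a))
    \<le> 2 * ((norm s ^ 2 + norm s) * exp (1 + norm s) / sin \<phi> ^ 2) * h"
proof -
  define K where "K = (norm s ^ 2 + norm s) * exp (1 + norm s) / sin \<phi> ^ 2"
  have sin: "sin \<phi> > 0" using phi by (rule sin_gt_zero)
  have K: "K \<ge> 0" unfolding K_def by (intro divide_nonneg_nonneg mult_nonneg_nonneg) auto
  have step: "norm (softplus (a - of_nat k * of_real h - s * of_real h) - softplus (a - of_nat k * of_real h)
      - s * (softplus (a - of_nat (Suc k) * of_real h) - softplus (a - of_nat k * of_real h)))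
      \<le> K * h ^ 2 * exp (- h) ^ k" for k
  proof -
    \<comment> \<open>The region contains \<open>p\<close>, \<open>p - h\<close> and
      \<open>p - s * h\<close>: the last shift costs at most \<open>h * norm s\<close> in the
      imaginary part and, as \<open>h \<le> 1\<close>, at most \<open>norm s\<close> in the real
      part.\<close>
    define S where "S = {v. \<bar>Im v\<bar> \<le> \<phi> \<and> Re v \<le> 1 + norm s - real k * h}"
    define p where "p = a - of_nat k * of_real h"
    have "S = {v. Im v \<le> \<phi>} \<inter> {v. Im v \<ge> - \<phi>} \<inter> {v. Re v \<le> 1 + norm s - real k * h}"
      by (auto simp: S_def)
    then have S: "convex S"
      by (simp add: convex_Int convex_halfspace_Im_le convex_halfspace_Im_ge convex_halfspace_Re_le)
    have M: "norm (exp v / (1 + exp v) ^ 2) \<le> exp (1 + norm s - real k * h) / sin \<phi> ^ 2" if "v \<in> S" for v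
    proof -
      have "sin \<phi> \<le> norm (1 + exp v)"
        using that phi by (intro norm_one_plus_exp_ge) (auto simp: S_def)
      then have "sin \<phi> ^ 2 \<le> norm (1 + exp v) ^ 2"
        using sin by (intro power_mono) auto
      moreover have "norm (exp v) \<le> exp (1 + norm s - real k * h)"
        using that by (simp add: S_def)
      ultimately show ?thesis
        using sin by (simp add: norm_divide norm_power frac_le)
    qed
    have abs: "\<bar>Im (s * of_real h)\<bar> \<le> h * norm s" "\<bar>Re (s * of_real h)\<bar> \<le> h * norm s"
      using abs_Im_le_cmod[of "s * of_real h"] abs_Re_le_cmod[of "s * of_real h"] h by (auto simp: norm_mult mult_ac)
    have "h * norm s \<le> 1 * norm s" using h by (intro mult_right_mono) auto
    then have hs: "h * norm s \<le> norm s" by simp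
    have hs0: "0 \<le> h * norm s" using h by simp
    have "norm (softplus (p + s * (- of_real h)) - softplus p - s * (softplus (p + (- of_real h)) - softplus p))
        \<le> (norm s ^ 2 + norm s) * norm (- of_real h :: complex) ^ 2 * (exp (1 + norm s - real k * h) / sin \<phi> ^ 2)"
    proof (rule second_difference_bound[where f' = "\<lambda>v. exp v / (1 + exp v)" and f'' = "\<lambda>v. exp v / (1 + exp v) ^ 2", OF S _ _ M])
      show "p \<in> S" "p + - complex_of_real h \<in> S" "p + s * - complex_of_real h \<in> S"
        using a abs hs hs0 h by (auto simp: S_def p_def)
    qed (use phi in \<open>auto intro!: softplus_derivatives simp: S_def\<close>)
    also have "\<dots> = K * h ^ 2 * exp (- h) ^ k"
      by (simp add: K_def exp_diff exp_minus field_simps flip: exp_of_nat_mult)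
    finally show ?thesis by (simp add: p_def algebra_simps)
  qed
  have "norm ((\<Sum>k<n. softplus (a - of_nat k * of_real h - s * of_real h) - softplus (a - of_nat k * of_real h))
      - s * (softplus (a - of_nat n * of_real h) - softplus (a - of_nat 0 * of_real h)))
    \<le> (\<Sum>k<n. K * h ^ 2 * exp (- h) ^ k)"
    by (rule sum_minus_telescope_bound) (rule step)
  also have "\<dots> = K * h ^ 2 * (\<Sum>k<n. exp (- h) ^ k)"
    by (simp add: sum_distrib_left)
  also have "(\<Sum>k<n. exp (- h) ^ k) \<le> 2 / h"
  proof -
    have "(\<Sum>k<n. exp (- h) ^ k) = (1 - exp (- h) ^ n) / (1 - exp (- h))"
      using h by (subst sum_gp_strict) auto
    also have "\<dots> \<le> 1 / (h / 2)"
      using h one_minus_exp_minus_ge[OF h] by (intro frac_le) auto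
    finally show ?thesis by simp
  qed
  then have "K * h ^ 2 * (\<Sum>k<n. exp (- h) ^ k) \<le> K * h ^ 2 * (2 / h)"
    using K by (intro mult_left_mono) auto
  also have "\<dots> = 2 * K * h"
    using h by (simp add: power2_eq_square)
  finally show ?thesis unfolding K_def by simp
qed

lemma qpoch_inf_exp_nonzero:
  assumes "0 < h" "\<bar>Im v\<bar> < pi"
  shows "qpoch_inf (- exp v) (of_real (exp (- h))) \<noteq> 0"
proof -
  have "1 - - exp v * of_real (exp (- h)) ^ k \<noteq> 0" for k
  proof -
    have "exp v * of_real (exp (- h)) ^ k = exp (v - of_nat k * of_real h)"
      by (simp add: exp_diff exp_minus field_simps flip: exp_of_real exp_of_nat_mult)
    then show ?thesis
      using one_plus_exp_nonzero[of "v - of_nat k * of_real h"] assms by simp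
  qed
  then show ?thesis
    using assms by (subst qpoch_inf_nonzero_iff) auto
qed

lemma theta_exp_nonzero:
  assumes "0 < h" "\<bar>Im v\<bar> < pi"
  shows "theta (of_real (exp (- h))) (exp v) \<noteq> 0"
proof -
  have "- of_real (exp (- h)) / exp v = - exp (- v - of_real h)"
    by (simp add: exp_diff exp_minus field_simps flip: exp_of_real)
  then show ?thesis
    using assms qpoch_inf_exp_nonzero[OF assms] qpoch_inf_exp_nonzero[of h "- v - of_real h"]
      qpoch_inf_nonzero[of "of_real (exp (- h))" "of_real (exp (- h))"]
    by (subst jacobi_triple_product) auto
qed

text \<open>Exponentiating undoes the branch choice factor by factor, so partial sums become
  quotients of partial products. The hypothesis keeps both \<open>a\<close> and
  \<open>a - s * h\<close> in the strip.\<close>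

lemma qpoch_inf_exp_quotient_tendsto:
  assumes h: "0 < h" and a: "\<bar>Im a\<bar> + h * norm s < pi"
  shows "(\<lambda>n. exp (\<Sum>k<n. softplus (a - of_nat k * of_real h - s * of_real h) - softplus (a - of_nat k * of_real h)))
    \<longlonglongrightarrow> qpoch_inf (- exp (a - s * of_real h)) (of_real (exp (- h))) / qpoch_inf (- exp a) (of_real (exp (- h)))"
proof -
  let ?q = "of_real (exp (- h)) :: complex"
  have q: "norm ?q < 1" using h by simp
  have "\<bar>Im (s * of_real h)\<bar> \<le> h * norm s"
    using abs_Im_le_cmod[of "s * of_real h"] h by (auto simp: norm_mult mult_ac)
  then have im: "\<bar>Im (a - s * of_real h)\<bar> < pi" "\<bar>Im a\<bar> < pi" using a by auto
  have fac: "exp (softplus (v - of_nat k * of_real h)) = 1 - - exp v * ?q ^ k" if "\<bar>Im v\<bar> < pi" for v k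
    using that by (subst exp_softplus) (simp_all add: exp_diff exp_minus field_simps flip: exp_of_real exp_of_nat_mult)
  have "exp (\<Sum>k<n. softplus (a - of_nat k * of_real h - s * of_real h) - softplus (a - of_nat k * of_real h))
     = (\<Prod>k<n. 1 - - exp (a - s * of_real h) * ?q ^ k) / (\<Prod>k<n. 1 - - exp a * ?q ^ k)" for n
  proof -
    have "exp (\<Sum>k<n. softplus (a - of_nat k * of_real h - s * of_real h) - softplus (a - of_nat k * of_real h))
     = (\<Prod>k<n. exp (softplus (a - s * of_real h - of_nat k * of_real h)) / exp (softplus (a - of_nat k * of_real h)))"
      by (simp add: exp_sum exp_diff algebra_simps)
    then show ?thesis unfolding fac[OF im(1)] fac[OF im(2)] prod_dividef .
  qed
  moreover have "(\<lambda>n. (\<Prod>k<n. 1 - - exp (a - s * of_real h) * ?q ^ k) / (\<Prod>k<n. 1 - - exp a * ?q ^ k))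
     \<longlonglongrightarrow> qpoch_inf (- exp (a - s * of_real h)) ?q / qpoch_inf (- exp a) ?q"
    by (intro tendsto_divide qpoch_inf_LIMSEQ q qpoch_inf_exp_nonzero h im)
  ultimately show ?thesis by simp
qed

text \<open>By the triple product the quotient consists of two product quotients, one at
  \<open>w\<close> with shift \<open>s\<close> and one at \<open>- w - h\<close> with shift
  \<open>- s\<close>. Telescoping leaves \<open>- s * (softplus w - softplus (- w - h))\<close>,
  which by \<open>softplus_reflect\<close> is \<open>- s * w\<close> up to order
  \<open>h\<close>.\<close>

lemma theta_quotient_bound:
  fixes s :: complex and \<phi> :: real
  assumes phi: "0 < \<phi>" "\<phi> < pi"
  obtains C h0 where "h0 > 0"
    "\<And>h w. \<lbrakk>0 < h; h < h0; \<bar>Im w\<bar> \<le> \<phi>; 0 \<le> Re w; Re w \<le> 1\<rbrakk> \<Longrightarrow>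
      norm (theta (of_real (exp (- h))) (exp (w - s * of_real h)) / theta (of_real (exp (- h))) (exp w) * exp (s * w) - 1) \<le> C * h"
proof -
  \<comment> \<open>The midpoint of \<open>\<phi>\<close> and \<open>pi\<close> leaves room in the
    strip for the shift by \<open>s * h\<close>.\<close>
  define \<phi>1 where "\<phi>1 = (\<phi> + pi) / 2"
  have phi1: "0 < \<phi>1" "\<phi>1 < pi" "\<phi> < \<phi>1" using phi by (auto simp: \<phi>1_def)
  have sin: "sin \<phi>1 > 0" using phi1 by (intro sin_gt_zero) auto
  define B where "B = 2 * ((norm s ^ 2 + norm s) * exp (1 + norm s) / sin \<phi>1 ^ 2)"
  define D where "D = 2 * B + norm s * (exp 1 / sin \<phi>1)"
  \<comment> \<open>The three bounds give \<open>h \<le> 1\<close>, keep the shifted arguments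
    within \<open>\<phi>1\<close>, and make \<open>norm (T n) \<le> 1\<close>, so that
    \<open>norm_exp_minus_one_le\<close> applies.\<close>
  define h0 where "h0 = Min {1, (\<phi>1 - \<phi>) / (norm s + 1), 1 / (D + 1)}"
  have B: "B \<ge> 0" unfolding B_def by (intro mult_nonneg_nonneg[of 2] divide_nonneg_nonneg mult_nonneg_nonneg) auto
  have D: "D \<ge> 0" using B sin unfolding D_def by (intro add_nonneg_nonneg mult_nonneg_nonneg) auto
  have pos: "norm s + 1 > 0" "D + 1 > 0" using D by (auto intro: add_nonneg_pos)
  show ?thesis
  proof (rule that)
    show "h0 > 0" using phi1 pos by (auto simp: h0_def)
    fix h :: real and w :: complex
    assume h: "0 < h" "h < h0" and w: "\<bar>Im w\<bar> \<le> \<phi>" "0 \<le> Re w" "Re w \<le> 1"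
    have h1: "h \<le> 1" "h * (norm s + 1) \<le> \<phi>1 - \<phi>" "h * (D + 1) \<le> 1"
      using h pos by (auto simp: h0_def pos_less_divide_eq less_imp_le)
    then have hs: "h * norm s \<le> \<phi>1 - \<phi>" "h * D \<le> 1"
      using h by (auto simp: algebra_simps)
    let ?q = "of_real (exp (- h)) :: complex"
    let ?v = "- w - of_real h"
    let ?l = "\<lambda>a n. softplus (a - of_nat n * of_real h)"
    define S1 where "S1 n = (\<Sum>k<n. softplus (w - of_nat k * of_real h - s * of_real h) - softplus (w - of_nat k * of_real h))" for n
    define S2 where "S2 n = (\<Sum>k<n. softplus (?v - of_nat k * of_real h - (- s) * of_real h) - softplus (?v - of_nat k * of_real h))" for n
    \<comment> \<open>A logarithm of the partial quotient times \<open>exp (s * w)\<close>; the two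
      terms with \<open>?l\<close> absorb the far ends of the telescoping sums and vanish in the
      limit.\<close>
    define T where "T n = S1 n + S2 n + s * w - s * ?l w n + s * ?l ?v n" for n
    have b1: "norm (S1 n - s * (?l w n - softplus w)) \<le> B * h" for n
      unfolding S1_def B_def using phi1 h h1 w hs by (intro softplus_sum_bound) auto
    have b2: "norm (S2 n - (- s) * (?l ?v n - softplus ?v)) \<le> B * h" for n
      unfolding S2_def B_def using phi1 h h1 w hs softplus_sum_bound[of \<phi>1 h ?v "- s" n] by simp
    have b3: "norm (softplus ?v - softplus (- w)) \<le> exp 1 / sin \<phi>1 * h"
    proof -
      let ?S = "{v. Im v \<le> \<phi>} \<inter> {v. Im v \<ge> - \<phi>} \<inter> {v. Re v \<le> 1}"
      have "norm (softplus ?v - softplus (- w)) \<le> exp 1 / sin \<phi>1 * norm (?v - (- w))"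
      proof (rule field_differentiable_bound[of ?S])
        show "convex ?S"
          by (simp add: convex_Int convex_halfspace_Im_le convex_halfspace_Im_ge convex_halfspace_Re_le)
        fix v assume v: "v \<in> ?S"
        then show "(softplus has_field_derivative exp v / (1 + exp v)) (at v within ?S)"
          using phi by (intro has_field_derivative_at_within[OF softplus_derivatives(1)]) auto
        have "sin \<phi>1 \<le> norm (1 + exp v)"
          using v phi1 by (intro norm_one_plus_exp_ge) auto
        then show "norm (exp v / (1 + exp v)) \<le> exp 1 / sin \<phi>1"
          using v sin unfolding norm_divide by (intro frac_le) auto
      qed (use w h in auto)
      then show ?thesis using h by simp
    qed
    have T: "norm (T n) \<le> D * h" for n
    proof -
      have "T n = (S1 n - s * (?l w n - softplus w)) + (S2 n - (- s) * (?l ?v n - softplus ?v))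
          + s * (softplus ?v - softplus (- w)) - s * (softplus w - softplus (- w) - w)"
        unfolding T_def by (simp add: algebra_simps)
      also have "softplus w - softplus (- w) - w = 0"
        using softplus_reflect[of w] w phi by simp
      finally have "T n = (S1 n - s * (?l w n - softplus w)) + (S2 n - (- s) * (?l ?v n - softplus ?v))
          + s * (softplus ?v - softplus (- w))" by simp
      moreover have "norm (s * (softplus ?v - softplus (- w))) \<le> norm s * (exp 1 / sin \<phi>1 * h)"
        unfolding norm_mult using b3 by (intro mult_left_mono) auto
      ultimately have "norm (T n) \<le> B * h + B * h + norm s * (exp 1 / sin \<phi>1 * h)"
        using b1[of n] b2[of n] by (metis add_mono norm_triangle_mono)
      then show ?thesis by (simp add: D_def algebra_simps)
    qed
    have expT: "norm (exp (T n) - 1) \<le> 3 * D * h" for n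
    proof -
      have "norm (T n) \<le> 1" using T[of n] hs by (simp add: mult.commute)
      from norm_exp_minus_one_le[OF this] T[of n] show ?thesis by simp
    qed
    have "(\<lambda>n. exp (S1 n) * exp (S2 n) * exp (s * w) * exp (s * ?l ?v n - s * ?l w n)) \<longlonglongrightarrow>
        (qpoch_inf (- exp (w - s * of_real h)) ?q / qpoch_inf (- exp w) ?q) *
        (qpoch_inf (- exp (?v - (- s) * of_real h)) ?q / qpoch_inf (- exp ?v) ?q) * exp (s * w) * exp (s * 0 - s * 0)"
      unfolding S1_def S2_def using h w phi1 hs
      by (intro tendsto_intros softplus_shift_tendsto qpoch_inf_exp_quotient_tendsto) auto
    moreover have "exp (S1 n) * exp (S2 n) * exp (s * w) * exp (s * ?l ?v n - s * ?l w n) = exp (T n)" for n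
      unfolding T_def exp_add[symmetric] by (rule arg_cong[of _ _ exp]) simp
    moreover have "(qpoch_inf (- exp (w - s * of_real h)) ?q / qpoch_inf (- exp w) ?q) *
        (qpoch_inf (- exp (?v - (- s) * of_real h)) ?q / qpoch_inf (- exp ?v) ?q) =
        theta ?q (exp (w - s * of_real h)) / theta ?q (exp w)"
    proof -
      have "- ?q / exp w = - exp ?v" "- ?q / exp (w - s * of_real h) = - exp (?v - (- s) * of_real h)"
        by (simp_all add: exp_diff exp_minus exp_add field_simps flip: exp_of_real)
      moreover have "qpoch_inf ?q ?q \<noteq> 0" using h by (intro qpoch_inf_nonzero) auto
      ultimately show ?thesis
        using h by (simp add: jacobi_triple_product)
    qed
    ultimately have "(\<lambda>n. exp (T n)) \<longlonglongrightarrow> theta ?q (exp (w - s * of_real h)) / theta ?q (exp w) * exp (s * w)"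
      by (simp only: diff_self exp_zero mult_1_right)
    then have "(\<lambda>n. norm (exp (T n) - 1)) \<longlonglongrightarrow>
        norm (theta ?q (exp (w - s * of_real h)) / theta ?q (exp w) * exp (s * w) - 1)"
      by (intro tendsto_intros)
    then show "norm (theta ?q (exp (w - s * of_real h)) / theta ?q (exp w) * exp (s * w) - 1) \<le> (3 * D) * h"
      by (rule LIMSEQ_le_const2) (use expT in auto)
  qed
qed

text \<open>The quasi-periodicity factors of numerator and denominator differ by
  \<open>exp (- s * n * h)\<close>, which the change of \<open>exp (s * w)\<close> compensates. So
  the bound for \<open>0 \<le> Re w \<le> 1\<close> reaches the whole strip.\<close>

lemma theta_quotient_periodic:
  fixes n :: int and s :: complex
  assumes h: "0 < h"
  defines "q \<equiv> complex_of_real (exp (- h))"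
  defines "R \<equiv> \<lambda>w. theta q (exp (w - s * of_real h)) / theta q (exp w) * exp (s * w)"
  shows "R (w - of_int n * of_real h) = R w"
proof -
  have q: "norm q < 1" "q \<noteq> 0" using h by (auto simp: q_def)
  have qn: "q powi n = exp (- (of_int n * of_real h))"
    unfolding q_def exp_of_real[symmetric] by (simp add: exp_power_int)
  define z where "z = exp w"
  define v where "v = exp (- (s * of_real h))"
  have z: "z \<noteq> 0" "v * z \<noteq> 0" by (auto simp: z_def v_def)
  have shift: "exp (w - of_int n * of_real h) = q powi n * z"
    "exp (w - of_int n * of_real h - s * of_real h) = q powi n * (v * z)"
    "exp (w - s * of_real h) = v * z"
    unfolding z_def v_def qn by (simp_all add: mult_exp_exp algebra_simps)
  have t: "theta_term q (v * z) n = exp (- (s * of_int n * of_real h)) * theta_term q z n"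
    unfolding theta_term_mult unfolding v_def by (simp add: exp_power_int mult_ac)
  have nz: "theta_term q z n \<noteq> 0" by (rule theta_term_nonzero[OF q(2) z(1)])
  have "R w = theta q (q powi n * (v * z)) * theta_term q (v * z) n / (theta q (q powi n * z) * theta_term q z n) * exp (s * w)"
    unfolding R_def shift theta_shift_int[OF q z(1)] theta_shift_int[OF q z(2)] z_def[symmetric] ..
  also have "\<dots> = theta q (q powi n * (v * z)) / theta q (q powi n * z) * (exp (- (s * of_int n * of_real h)) * exp (s * w))"
    unfolding t using nz by simp
  also have "exp (- (s * of_int n * of_real h)) * exp (s * w) = exp (s * (w - of_int n * of_real h))"
    by (simp add: mult_exp_exp algebra_simps)
  finally show ?thesis unfolding R_def shift by simp
qed

text \<open>\<open>W\<close> may vary with \<open>h\<close> and have unbounded real part; in the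
  application it is a logarithm of \<open>lam / ((1 - q) * x)\<close>, whose modulus tends to
  infinity.\<close>

lemma theta_quotient_tendsto:
  fixes s :: complex and W :: "real \<Rightarrow> complex"
  assumes phi: "\<phi> < pi" and W: "\<And>h. \<bar>Im (W h)\<bar> \<le> \<phi>"
  shows "((\<lambda>h. theta (of_real (exp (- h))) (exp (W h - s * of_real h)) / theta (of_real (exp (- h))) (exp (W h))
      * exp (s * W h)) \<longlongrightarrow> 1) (at_right 0)"
proof -
  \<comment> \<open>\<open>\<phi>\<close> may be 0, whereas \<open>theta_quotient_bound\<close> asks
    for a positive width.\<close>
  define \<psi> where "\<psi> = (\<phi> + pi) / 2"
  have "0 \<le> \<phi>" using W[of 0] by linarith
  then have psi: "0 < \<psi>" "\<psi> < pi" "\<phi> \<le> \<psi>" using phi pi_gt_zero by (auto simp: \<psi>_def)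
  define R where "R = (\<lambda>h w. theta (of_real (exp (- h))) (exp (w - s * of_real h)) / theta (of_real (exp (- h))) (exp w) * exp (s * w))"
  obtain C h0 where C: "h0 > 0" "\<And>h w. \<lbrakk>0 < h; h < h0; \<bar>Im w\<bar> \<le> \<psi>; 0 \<le> Re w; Re w \<le> 1\<rbrakk> \<Longrightarrow> norm (R h w - 1) \<le> C * h"
    unfolding R_def using theta_quotient_bound[OF psi(1,2), of s] by metis
  have "\<forall>\<^sub>F h in at_right 0. norm (R h (W h) - 1) \<le> C * h"
  proof -
    have "\<forall>\<^sub>F h in at_right 0. h \<in> {0<..<min h0 1}"
      using C(1) by (intro eventually_at_right_real) auto
    then show ?thesis
    proof eventually_elim
      case (elim h)
      \<comment> \<open>Reduction by multiples of \<open>h\<close> to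
        \<open>0 \<le> Re w < h\<close>, inside the unit interval because
        \<open>h < 1\<close>.\<close>
      define n where "n = \<lfloor>Re (W h) / h\<rfloor>"
      define w where "w = W h - of_int n * of_real h"
      have "of_int n \<le> Re (W h) / h" "Re (W h) / h < of_int n + 1" unfolding n_def by linarith+
      then have "of_int n * h \<le> Re (W h)" "Re (W h) < (of_int n + 1) * h"
        using elim by (auto simp: pos_le_divide_eq pos_divide_less_eq)
      then have "0 \<le> Re w" "Re w \<le> 1" "\<bar>Im w\<bar> \<le> \<psi>"
        using elim W[of h] psi by (auto simp: w_def algebra_simps)
      then have "norm (R h w - 1) \<le> C * h" using elim by (intro C) auto
      moreover have "R h w = R h (W h)"
        unfolding w_def R_def using elim by (intro theta_quotient_periodic) auto
      ultimately show ?case by simp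
    qed
  qed
  moreover have "((\<lambda>h. C * h) \<longlongrightarrow> 0) (at_right 0)"
    by (rule tendsto_eq_intros refl)+ simp
  ultimately have "((\<lambda>h. R h (W h) - 1) \<longlongrightarrow> 0) (at_right 0)"
    by (rule Lim_null_comparison)
  then show ?thesis unfolding R_def by (simp add: LIM_zero_iff)
qed

section \<open>The limit of the infinite product at \<open>(1 - q) * x\<close>\<close>

lemma one_minus_exp_quotient_tendsto:
  fixes c :: complex
  shows "((\<lambda>h. (1 - exp (- (of_real h * c))) / of_real h) \<longlongrightarrow> c) (at_right 0)"
proof -
  have "((\<lambda>z. 1 - exp (- (z * c))) has_field_derivative c) (at 0)"
    by (auto intro!: derivative_eq_intros)
  then have "((\<lambda>z. (1 - exp (- (z * c))) / z) \<longlongrightarrow> c) (at 0)"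
    by (simp add: has_field_derivative_iff)
  moreover have "filterlim (\<lambda>h. complex_of_real h) (at 0) (at_right 0)"
    unfolding filterlim_at by (auto intro!: tendsto_eq_intros eventually_at_right_less simp: eventually_at_filter)
  ultimately show ?thesis
    by (rule filterlim_compose)
qed

lemma one_minus_exp_ratio_tendsto:
  fixes c d :: complex
  assumes "d \<noteq> 0"
  shows "((\<lambda>h. (1 - exp (- (of_real h * c))) / (1 - exp (- (of_real h * d)))) \<longlongrightarrow> c / d) (at_right 0)"
proof -
  have "((\<lambda>h. ((1 - exp (- (of_real h * c))) / of_real h) / ((1 - exp (- (of_real h * d))) / of_real h)) \<longlongrightarrow> c / d) (at_right 0)"
    using assms by (intro tendsto_divide one_minus_exp_quotient_tendsto)
  moreover have "\<forall>\<^sub>F h in at_right 0. ((1 - exp (- (of_real h * c))) / of_real h) / ((1 - exp (- (of_real h * d))) / of_real h)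
     = (1 - exp (- (of_real h * c))) / (1 - exp (- (of_real h * d)))"
    using eventually_at_right_less[of "0::real"] by eventually_elim auto
  ultimately show ?thesis
    by (rule Lim_transform_eventually)
qed

text \<open>Tannery's theorem for Euler's series. Up to sign, the coefficient of
  \<open>x ^ m\<close> is the product over \<open>k < m\<close> of
  \<open>q ^ k * (1 - q) / (1 - q ^ (k + 1))\<close>; each factor tends to
  \<open>1 / (k + 1)\<close> and is bounded by it, so \<open>1 / fact m\<close> dominates.\<close>

lemma qpoch_inf_exp_tendsto:
  fixes x :: complex
  shows "((\<lambda>h. qpoch_inf (of_real (1 - exp (- h)) * x) (of_real (exp (- h)))) \<longlongrightarrow> exp (- x)) (at_right 0)"
proof -
  define a where "a m h = E_coeff (of_real (exp (- h))) m * of_real (1 - exp (- h)) ^ m" for m h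
  have rec: "a (Suc m) h = - a m h * of_real (exp (- h)) ^ m * ((1 - exp (- (of_real h * 1))) / (1 - exp (- (of_real h * of_nat (Suc m)))))" for m h
  proof -
    have "of_real (exp (- h)) ^ Suc m = exp (- (complex_of_real h * of_nat (Suc m)))"
      unfolding exp_of_real[symmetric] by (subst exp_of_nat_mult[symmetric]) (simp only: of_real_minus mult_minus_right mult_minus_left mult.commute)
    moreover have "complex_of_real (1 - exp (- h)) = 1 - exp (- (of_real h * 1))"
      by (simp add: exp_of_real[symmetric])
    ultimately show ?thesis
      unfolding a_def E_coeff.simps power_Suc[of "of_real (1 - exp (- h))"] by simp
  qed
  have lim: "((\<lambda>h. a m h) \<longlongrightarrow> (- 1) ^ m / fact m) (at_right 0)" for m
  proof (induction m)
    case 0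
    then show ?case by (simp add: a_def)
  next
    case (Suc m)
    have "((\<lambda>h. - a m h * of_real (exp (- h)) ^ m * ((1 - exp (- (of_real h * 1))) / (1 - exp (- (of_real h * of_nat (Suc m))))))
       \<longlongrightarrow> - ((- 1) ^ m / fact m) * of_real (exp (- 0)) ^ m * (1 / of_nat (Suc m))) (at_right 0)"
      by (intro tendsto_intros Suc.IH one_minus_exp_ratio_tendsto) (auto simp del: of_nat_Suc)
    then show ?case
      unfolding rec by (simp del: of_nat_Suc add: mult.commute)
  qed
  have bound: "norm (a m h) \<le> 1 / fact m" if h: "h > 0" for m h
  proof (induction m)
    case 0
    then show ?case by (simp add: a_def)
  next
    case (Suc m)
    define q where "q = exp (- h)"
    have q: "0 < q" "q < 1" using h by (auto simp: q_def)
    have "real (Suc m) * q ^ m = (\<Sum>i<Suc m. q ^ m)" by simp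
    also have "\<dots> \<le> (\<Sum>i<Suc m. q ^ i)"
      using q by (intro sum_mono power_decreasing) auto
    also have "\<dots> = (1 - q ^ Suc m) / (1 - q)"
      using q by (subst sum_gp_strict) auto
    finally have *: "real (Suc m) * q ^ m * (1 - q) \<le> 1 - q ^ Suc m"
      using q by (simp add: pos_le_divide_eq)
    have "q ^ Suc m < 1" using q by (intro power_less_one_iff[THEN iffD2]) auto
    then have "q ^ m * ((1 - q) / (1 - q ^ Suc m)) \<le> 1 / real (Suc m)"
      using * by (simp add: field_simps del: of_nat_Suc power_Suc)
    have "a (Suc m) h = - a m h * of_real (q ^ m * ((1 - q) / (1 - q ^ Suc m)))"
      by (simp add: a_def q_def)
    then have "norm (a (Suc m) h) = norm (a m h) * (q ^ m * ((1 - q) / (1 - q ^ Suc m)))"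
      using q \<open>q ^ Suc m < 1\<close> by (simp only: norm_mult norm_minus_cancel norm_of_real) (subst abs_of_nonneg, auto)
    also have "\<dots> \<le> 1 / fact m * (1 / real (Suc m))"
      using Suc.IH \<open>q ^ m * _ \<le> _\<close> q \<open>q ^ Suc m < 1\<close> by (intro mult_mono) auto
    finally show ?case by (simp add: mult.commute)
  qed
  have "((\<lambda>h. \<Sum>m. a m h * x ^ m) \<longlongrightarrow> (\<Sum>m. (- 1) ^ m / fact m * x ^ m)) (at_right 0)"
  proof (rule tannerys_theorem[THEN conjunct2, THEN conjunct2])
    show "((\<lambda>h. a m h * x ^ m) \<longlongrightarrow> (- 1) ^ m / fact m * x ^ m) (at_right 0)" for m
      by (intro tendsto_intros lim)
    have "\<forall>\<^sub>F (m, h) in at_top \<times>\<^sub>F at_right 0. h > (0::real)"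
      using eventually_at_right_less[of "0::real"]
      by (auto simp: case_prod_unfold intro!: eventually_compose_filterlim[OF _ filterlim_snd])
    then show "\<forall>\<^sub>F (m, h) in at_top \<times>\<^sub>F at_right 0. norm (a m h * x ^ m) \<le> inverse (fact m) * norm x ^ m"
    proof eventually_elim
      case (elim mh)
      have "norm (a m h * x ^ m) \<le> inverse (fact m) * norm x ^ m" if "h > 0" for m h
        using mult_right_mono[OF bound[OF that, of m], of "norm x ^ m"]
        by (simp add: norm_mult norm_power inverse_eq_divide)
      then show ?case using elim by (simp add: case_prod_unfold)
    qed
    show "summable (\<lambda>m. inverse (fact m) * norm x ^ m)"
      by (rule summable_exp)
  qed auto
  moreover have "(\<Sum>m. (- 1) ^ m / fact m * x ^ m) = exp (- x)"
    unfolding exp_def by (intro suminf_cong) (simp add: scaleR_conv_of_real divide_inverse power_minus[of x])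
  moreover have "(\<Sum>m. a m h * x ^ m) = qpoch_inf (of_real (1 - exp (- h)) * x) (of_real (exp (- h)))" for h
    unfolding qpoch_inf_def a_def by (simp add: power_mult_distrib mult.assoc)
  ultimately show ?thesis by simp
qed

section \<open>The limit of the q-Gamma function\<close>

text \<open>For \<open>q = exp (- h)\<close> this is a logarithm of \<open>1 - q powr t\<close>, a
  factor of the q-Gamma product; when \<open>h > 0\<close> and \<open>Re t > 0\<close>, the argument
  of \<open>Ln\<close> stays in the right half-plane, away from the cut.\<close>

definition qlog :: "real \<Rightarrow> complex \<Rightarrow> complex" where
  "qlog h t = Ln (1 - exp (- (of_real h * t)))"

lemma Re_one_minus_exp_pos:
  assumes "0 < h" "0 < Re t"
  shows "0 < Re (1 - exp (- (of_real h * t)))"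
proof -
  have "Re (exp (- (of_real h * t))) \<le> norm (exp (- (of_real h * t)))"
    by (rule complex_Re_le_cmod)
  also have "\<dots> < 1" using assms by simp
  finally show ?thesis by simp
qed

lemma exp_qlog:
  assumes "0 < h" "0 < Re t"
  shows "exp (qlog h t) = 1 - exp (- (of_real h * t))"
  using Re_one_minus_exp_pos[OF assms] unfolding qlog_def by (intro exp_Ln) auto

lemma qlog_derivatives:
  assumes "0 < h" "0 < Re t"
  defines "e \<equiv> \<lambda>t. exp (- (of_real h * t))"
  shows "(qlog h has_field_derivative of_real h * e t / (1 - e t)) (at t)"
    and "((\<lambda>t. of_real h * e t / (1 - e t)) has_field_derivative - (of_real h ^ 2 * e t / (1 - e t) ^ 2)) (at t)"
proof -
  have pos: "0 < Re (1 - e t)" unfolding e_def by (rule Re_one_minus_exp_pos[OF assms(1,2)])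
  then have nz: "1 - e t \<noteq> 0" by auto
  have e: "(e has_field_derivative - of_real h * e t) (at t)"
    unfolding e_def by (auto intro!: derivative_eq_intros)
  have "1 - e t \<notin> \<real>\<^sub>\<le>\<^sub>0" using pos by (auto simp: complex_nonpos_Reals_iff)
  then have "((\<lambda>t. Ln (1 - e t)) has_field_derivative of_real h * e t / (1 - e t)) (at t)"
    by (auto intro!: derivative_eq_intros e simp: field_simps nz)
  then show "(qlog h has_field_derivative of_real h * e t / (1 - e t)) (at t)"
    unfolding qlog_def[abs_def] e_def .
  show "((\<lambda>t. of_real h * e t / (1 - e t)) has_field_derivative - (of_real h ^ 2 * e t / (1 - e t) ^ 2)) (at t)"
    using nz by (auto intro!: derivative_eq_intros e simp: field_simps power2_eq_square)
qed

text \<open>With \<open>x = h * Re t\<close>, \<open>norm (1 - exp (- h * t))\<close> is at least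
  \<open>exp (- x / 2) * x / 2\<close>, whose square cancels the \<open>exp (- x)\<close> and the
  \<open>h ^ 2\<close> of the numerator. The bound is free of \<open>h\<close>, which makes the tail
  estimates uniform as \<open>q\<close> tends to 1.\<close>

lemma qlog_second_derivative_bound:
  assumes h: "0 < h" and t: "0 < r" "r \<le> Re t"
  shows "norm (- (of_real h ^ 2 * exp (- (of_real h * t)) / (1 - exp (- (of_real h * t))) ^ 2)) \<le> 4 / r ^ 2"
proof -
  define x where "x = h * Re t"
  have x: "0 < x" "h * r \<le> x" using h t by (auto simp: x_def)
  have e: "norm (exp (- (of_real h * t))) = exp (- x)" by (simp add: x_def)
  have "1 - exp (- x) \<le> norm (1 - exp (- (of_real h * t)))"
    using norm_triangle_ineq2[of 1 "exp (- (of_real h * t))"] e by simp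
  moreover have "exp (- (x / 2)) * (x / 2) \<le> 1 - exp (- x)"
  proof -
    have "exp (- x) = exp (- (x / 2)) * exp (- (x / 2))"
      by (simp flip: exp_add)
    moreover have "exp (- (x / 2)) * exp (x / 2) = 1"
      by (simp flip: exp_add)
    ultimately have "1 - exp (- x) = exp (- (x / 2)) * (exp (x / 2) - exp (- (x / 2)))"
      by (simp add: algebra_simps)
    moreover have "x / 2 \<le> exp (x / 2) - exp (- (x / 2))"
    proof -
      have "exp (- (x / 2)) \<le> 1" using x by simp
      then show ?thesis using exp_ge_add_one_self[of "x / 2"] by linarith
    qed
    ultimately show ?thesis by (simp only: mult_le_cancel_left_pos exp_gt_zero)
  qed
  ultimately have "(exp (- (x / 2)) * (x / 2)) ^ 2 \<le> norm (1 - exp (- (of_real h * t))) ^ 2"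
    using x by (intro power_mono) auto
  moreover have "(exp (- (x / 2)) * (x / 2)) ^ 2 = exp (- x) * (x\<^sup>2 / 4)"
    by (simp add: power_mult_distrib power_divide flip: exp_of_nat_mult)
  ultimately have "exp (- x) * (x\<^sup>2 / 4) \<le> norm (1 - exp (- (of_real h * t))) ^ 2" by simp
  moreover have "exp (- x) * ((h * r)\<^sup>2 / 4) \<le> exp (- x) * (x\<^sup>2 / 4)"
    using x h t by (intro mult_left_mono divide_right_mono power_mono) auto
  ultimately have lower: "exp (- x) * ((h * r)\<^sup>2 / 4) \<le> norm (1 - exp (- (of_real h * t))) ^ 2" by linarith
  have pos: "0 < exp (- x) * ((h * r)\<^sup>2 / 4)" using h t by simp
  have "h ^ 2 * exp (- x) / norm (1 - exp (- (of_real h * t))) ^ 2 \<le> h ^ 2 * exp (- x) / (exp (- x) * ((h * r)\<^sup>2 / 4))"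
    by (rule frac_le[OF _ order.refl pos lower]) simp
  also have "\<dots> = 4 / r ^ 2"
    using h t by (simp add: power_mult_distrib field_simps)
  finally show ?thesis
    using e by (simp add: norm_mult norm_divide norm_power)
qed

text \<open>Each term \<open>1 / m ^ 2\<close> is compared with the telescoping difference
  \<open>1 / (m - 1) - 1 / m\<close>.\<close>

lemma sum_inverse_squares_le:
  assumes "N \<ge> 2"
  shows "(\<Sum>k<n. 1 / real (N + k) ^ 2) \<le> 1 / (real N - 1)"
proof -
  have "(\<Sum>k<n. 1 / real (N + k) ^ 2) \<le> 1 / (real N - 1) - 1 / (real (N + n) - 1)"
  proof (induction n)
    case (Suc n)
    have "1 / real (N + n) ^ 2 \<le> 1 / (real (N + n) - 1) - 1 / (real (N + Suc n) - 1)"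
    proof -
      have "0 < (real (N + n) - 1) * real (N + n)" using assms by (intro mult_pos_pos) auto
      then have "1 / real (N + n) ^ 2 \<le> 1 / ((real (N + n) - 1) * real (N + n))"
        unfolding power2_eq_square using assms by (intro divide_left_mono mult_right_mono) auto
      also have "\<dots> = 1 / (real (N + n) - 1) - 1 / (real (N + Suc n) - 1)"
        using assms by (simp add: field_simps)
      finally show ?thesis .
    qed
    then show ?case using Suc.IH by simp
  qed simp
  also have "\<dots> \<le> 1 / (real N - 1)" using assms by simp
  finally show ?thesis .
qed

text \<open>Second differences with step 1 along the integers from \<open>N\<close> on; the second
  derivative is of order \<open>1 / (N + k) ^ 2\<close>, so the errors add up to order
  \<open>1 / N\<close>.\<close>

lemma qlog_sum_bound:
  fixes b :: complex
  assumes h: "0 < h" and N: "real N \<ge> 2 * norm b + 2"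
  shows "norm ((\<Sum>k<n. qlog h (of_nat (N + k) + b) - qlog h (of_nat (N + k))) - b * (qlog h (of_nat (N + n)) - qlog h (of_nat N)))
    \<le> 16 * (norm b ^ 2 + norm b) / (real N - 1)"
proof -
  let ?C = "16 * (norm b ^ 2 + norm b)"
  have N2: "N \<ge> 2" using N norm_ge_zero[of b] by linarith
  have step: "norm ((qlog h (of_nat (N + k) + b) - qlog h (of_nat (N + k))) - b * (qlog h (of_nat (N + Suc k)) - qlog h (of_nat (N + k))))
      \<le> ?C * (1 / real (N + k) ^ 2)" for k
  proof -
    \<comment> \<open>As \<open>norm b \<le> N / 2\<close>, the half-plane
      \<open>Re t \<ge> r\<close> contains the point shifted by \<open>b\<close>;
      \<open>4 / r ^ 2\<close> yields the constant 16.\<close>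
    define r where "r = real (N + k) / 2"
    have r: "r > 0" using N2 by (simp add: r_def)
    have b: "\<bar>Re b\<bar> \<le> r" using abs_Re_le_cmod[of b] N by (simp add: r_def)
    let ?e = "\<lambda>t. exp (- (of_real h * t)) :: complex"
    have "norm (qlog h (of_nat (N + k) + b * 1) - qlog h (of_nat (N + k)) - b * (qlog h (of_nat (N + k) + 1) - qlog h (of_nat (N + k))))
      \<le> (norm b ^ 2 + norm b) * norm (1::complex) ^ 2 * (4 / r ^ 2)"
    proof (rule second_difference_bound[where S = "{t. Re t \<ge> r}" and f' = "\<lambda>t. of_real h * ?e t / (1 - ?e t)"
          and f'' = "\<lambda>t. - (of_real h ^ 2 * ?e t / (1 - ?e t) ^ 2)"])
      show "convex {t. Re t \<ge> r}" by (rule convex_halfspace_Re_ge)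
      show "of_nat (N + k) \<in> {t. r \<le> Re t}" "of_nat (N + k) + 1 \<in> {t. r \<le> Re t}" "of_nat (N + k) + b * 1 \<in> {t. r \<le> Re t}"
        using b r by (auto simp: r_def)
      fix t assume "t \<in> {t. r \<le> Re t}"
      then have t: "r \<le> Re t" "0 < Re t" using r by auto
      show "(qlog h has_field_derivative of_real h * ?e t / (1 - ?e t)) (at t)"
        "((\<lambda>t. of_real h * ?e t / (1 - ?e t)) has_field_derivative - (of_real h ^ 2 * ?e t / (1 - ?e t) ^ 2)) (at t)"
        "norm (- (of_real h ^ 2 * ?e t / (1 - ?e t) ^ 2)) \<le> 4 / r ^ 2"
        using qlog_derivatives[OF h t(2)] qlog_second_derivative_bound[OF h r t(1)] by blast+
    qed
    also have "\<dots> = ?C * (1 / real (N + k) ^ 2)"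
      by (simp add: r_def power_divide)
    finally show ?thesis by (simp add: add_ac)
  qed
  have "norm ((\<Sum>k<n. qlog h (of_nat (N + k) + b) - qlog h (of_nat (N + k))) - b * (qlog h (of_nat (N + n)) - qlog h (of_nat (N + 0))))
    \<le> (\<Sum>k<n. ?C * (1 / real (N + k) ^ 2))"
    by (rule sum_minus_telescope_bound) (rule step)
  also have "\<dots> = ?C * (\<Sum>k<n. 1 / real (N + k) ^ 2)"
    by (rule sum_distrib_left[symmetric])
  also have "\<dots> \<le> ?C * (1 / (real N - 1))"
    by (intro mult_left_mono sum_inverse_squares_le N2) auto
  finally show ?thesis by simp
qed

lemma qlog_tendsto:
  assumes "0 < h"
  shows "(\<lambda>n. qlog h (of_nat (N + n))) \<longlonglongrightarrow> 0"
proof -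
  have "norm (exp (- of_real h :: complex)) < 1" using assms by simp
  then have "(\<lambda>n. exp (- of_real h :: complex) ^ (n + N)) \<longlonglongrightarrow> 0"
    by (intro LIMSEQ_ignore_initial_segment LIMSEQ_power_zero)
  moreover have "exp (- of_real h :: complex) ^ (n + N) = exp (- (of_real h * of_nat (N + n)))" for n
    unfolding exp_of_nat_mult[symmetric] by (simp add: algebra_simps)
  ultimately have "(\<lambda>n. exp (- (complex_of_real h * of_nat (N + n)))) \<longlonglongrightarrow> 0" by simp
  then have "(\<lambda>n. Ln (1 - exp (- (complex_of_real h * of_nat (N + n))))) \<longlonglongrightarrow> Ln (1 - 0)"
    by (intro tendsto_intros) auto
  then show ?thesis by (simp add: qlog_def)
qed

text \<open>The logarithm of the tail quotient is a telescoping sum with step 1 minus the sum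
  \<open>S n\<close>, which \<open>qlog_sum_bound\<close> compares with \<open>b\<close> times the
  same telescope. What remains is \<open>b - 1\<close> times \<open>qlog h (of_nat N)\<close>, up to
  an error uniform in \<open>h\<close>.\<close>

lemma qpoch_inf_tail_bound:
  fixes b :: complex
  assumes h: "0 < h" and N: "real N \<ge> 2 * norm b + 2" and small: "16 * (norm b ^ 2 + norm b) \<le> real N - 1"
  defines "q \<equiv> complex_of_real (exp (- h))"
  shows "norm (qpoch_inf (exp (- (of_real h * (of_nat N + 1)))) q / qpoch_inf (exp (- (of_real h * (of_nat N + b)))) q
      * exp ((1 - b) * qlog h (of_nat N)) - 1) \<le> 48 * (norm b ^ 2 + norm b) / (real N - 1)"
proof -
  let ?C = "16 * (norm b ^ 2 + norm b)"
  have N2: "real N > 1" using N norm_ge_zero[of b] by linarith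
  have q: "norm q < 1" using h by (simp add: q_def)
  have Reb: "0 < Re (of_nat (N + k) + b)" for k
    using abs_Re_le_cmod[of b] N norm_ge_zero[of b] by simp
  have fac: "1 - exp (- (of_real h * (of_nat N + c))) * q ^ k = 1 - exp (- (of_real h * (of_nat (N + k) + c)))" for c k
    unfolding q_def by (simp add: exp_diff exp_minus exp_add ring_distribs field_simps flip: exp_of_real exp_of_nat_mult)
  define S where "S n = (\<Sum>k<n. qlog h (of_nat (N + k) + b) - qlog h (of_nat (N + k)))" for n
  \<comment> \<open>The last term tends to 0 with \<open>n\<close>; it makes \<open>T n\<close>, up
    to sign, exactly the error estimated by \<open>qlog_sum_bound\<close>.\<close>
  define T where "T n = qlog h (of_nat (N + n)) - qlog h (of_nat N) - S n + (1 - b) * qlog h (of_nat N) - (1 - b) * qlog h (of_nat (N + n))" for n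
  have "norm (T n) \<le> ?C / (real N - 1)" for n
  proof -
    have "T n = - (S n - b * (qlog h (of_nat (N + n)) - qlog h (of_nat N)))"
      unfolding T_def by (simp add: algebra_simps)
    then show ?thesis using qlog_sum_bound[OF h N, of n] unfolding S_def by (simp only: norm_minus_cancel)
  qed
  moreover have "?C / (real N - 1) \<le> 1" using small N2 by simp
  ultimately have expT: "norm (exp (T n) - 1) \<le> 3 * (?C / (real N - 1))" for n
    by (meson norm_exp_minus_one_le order.trans mult_left_mono zero_le_numeral)
  have prod: "exp (qlog h (of_nat (N + n)) - qlog h (of_nat N) - S n) =
      (\<Prod>k<n. 1 - exp (- (of_real h * (of_nat N + 1))) * q ^ k) / (\<Prod>k<n. 1 - exp (- (of_real h * (of_nat N + b))) * q ^ k)" for n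
  proof -
    have "qlog h (of_nat (N + n)) - qlog h (of_nat N) = (\<Sum>k<n. qlog h (of_nat (N + Suc k)) - qlog h (of_nat (N + k)))"
      using sum_lessThan_telescope[of "\<lambda>k. qlog h (of_nat (N + k))" n] by simp
    then have "qlog h (of_nat (N + n)) - qlog h (of_nat N) - S n = (\<Sum>k<n. qlog h (of_nat (N + k) + 1) - qlog h (of_nat (N + k) + b))"
      unfolding S_def by (simp add: add_ac flip: sum_subtractf)
    then have "exp (qlog h (of_nat (N + n)) - qlog h (of_nat N) - S n) =
      (\<Prod>k<n. exp (qlog h (of_nat (N + k) + 1)) / exp (qlog h (of_nat (N + k) + b)))"
      by (simp add: exp_sum exp_diff)
    also have "\<dots> = (\<Prod>k<n. (1 - exp (- (of_real h * (of_nat N + 1))) * q ^ k) / (1 - exp (- (of_real h * (of_nat N + b))) * q ^ k))"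
      unfolding fac by (intro prod.cong refl arg_cong2[of _ _ _ _ "(/)"] exp_qlog h Reb) auto
    finally show ?thesis unfolding prod_dividef .
  qed
  have den: "qpoch_inf (exp (- (of_real h * (of_nat N + b)))) q \<noteq> 0"
    using h Reb[of 0] by (intro qpoch_inf_nonzero q) auto
  have "(\<lambda>n. exp (qlog h (of_nat (N + n)) - qlog h (of_nat N) - S n) * exp ((1 - b) * qlog h (of_nat N)) * exp (- ((1 - b) * qlog h (of_nat (N + n)))))
    \<longlonglongrightarrow> qpoch_inf (exp (- (of_real h * (of_nat N + 1)))) q / qpoch_inf (exp (- (of_real h * (of_nat N + b)))) q
      * exp ((1 - b) * qlog h (of_nat N)) * exp (- ((1 - b) * 0))"
    unfolding prod by (intro tendsto_intros qpoch_inf_LIMSEQ q qlog_tendsto h den)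
  moreover have "exp (qlog h (of_nat (N + n)) - qlog h (of_nat N) - S n) * exp ((1 - b) * qlog h (of_nat N)) * exp (- ((1 - b) * qlog h (of_nat (N + n)))) = exp (T n)" for n
    unfolding exp_add[symmetric] T_def by (rule arg_cong[of _ _ exp]) simp
  ultimately have "(\<lambda>n. exp (T n)) \<longlonglongrightarrow> qpoch_inf (exp (- (of_real h * (of_nat N + 1)))) q / qpoch_inf (exp (- (of_real h * (of_nat N + b)))) q
      * exp ((1 - b) * qlog h (of_nat N))"
    by (simp only: mult_zero_right minus_zero exp_zero mult_1_right)
  then have "(\<lambda>n. norm (exp (T n) - 1)) \<longlonglongrightarrow> norm (qpoch_inf (exp (- (of_real h * (of_nat N + 1)))) q / qpoch_inf (exp (- (of_real h * (of_nat N + b)))) q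
      * exp ((1 - b) * qlog h (of_nat N)) - 1)"
    by (intro tendsto_intros)
  then have "norm (qpoch_inf (exp (- (of_real h * (of_nat N + 1)))) q / qpoch_inf (exp (- (of_real h * (of_nat N + b)))) q
      * exp ((1 - b) * qlog h (of_nat N)) - 1) \<le> 3 * (?C / (real N - 1))"
    by (rule LIMSEQ_le_const2) (use expT in auto)
  then show ?thesis by simp
qed

text \<open>Cut the product at \<open>N\<close>. For fixed \<open>N\<close> the head
  \<open>P N\<close> tends to \<open>Gamma_series' b N\<close>, and the tail changes it by a
  relative error of order \<open>1 / N\<close>, uniform in \<open>h\<close>. Choosing
  \<open>N\<close> first and \<open>h\<close> afterwards gives the limit.\<close>

lemma q_Gamma_tendsto:
  fixes b :: complex
  assumes b: "b \<notin> \<int>\<^sub>\<le>\<^sub>0"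
  shows "((\<lambda>h. qpoch_inf (of_real (exp (- h))) (of_real (exp (- h))) / qpoch_inf (exp (- (of_real h * b))) (of_real (exp (- h)))
      * exp ((1 - b) * of_real (ln (1 - exp (- h))))) \<longlongrightarrow> Gamma b) (at_right 0)"
    (is "(?T \<longlongrightarrow> _) _")
proof -
  \<comment> \<open>The power of the q-number \<open>(1 - q ^ N) / (1 - q)\<close> combines the
    prefactor \<open>(1 - q) powr (1 - b)\<close> with the factor
    \<open>(1 - q ^ N) powr (b - 1)\<close> contributed by the tail.\<close>
  define P where "P N h = (\<Prod>k<N. (1 - exp (- (of_real h * (of_nat k + 1)))) / (1 - exp (- (of_real h * (of_nat k + b)))))
      * exp ((b - 1) * of_real (ln ((1 - exp (- (h * real N))) / (1 - exp (- h)))))" for N :: nat and h :: real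
  have P_lim: "((\<lambda>h. P N h) \<longlongrightarrow> Gamma_series' b N) (at_right 0)" if N: "N > 0" for N
  proof -
    have nz: "of_nat k + b \<noteq> 0" for k
      using b by (metis add.commute add_eq_0_iff minus_of_nat_in_nonpos_Ints)
    have "((\<lambda>h. complex_of_real ((1 - exp (- (h * real N))) / (1 - exp (- h)))) \<longlongrightarrow> of_real (real N)) (at_right 0)"
      using one_minus_exp_ratio_tendsto[of 1 "of_nat N"] by (simp add: exp_of_real[symmetric])
    then have "((\<lambda>h. (1 - exp (- (h * real N))) / (1 - exp (- h))) \<longlongrightarrow> real N) (at_right 0)"
      unfolding tendsto_of_real_iff .
    then have "((\<lambda>h. P N h) \<longlongrightarrow> (\<Prod>k<N. (of_nat k + 1) / (of_nat k + b)) * exp ((b - 1) * of_real (ln (real N)))) (at_right 0)"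
      unfolding P_def using N by (intro tendsto_intros one_minus_exp_ratio_tendsto nz) auto
    also have "(\<Prod>k<N. (of_nat k + 1) / (of_nat k + b)) = fact N / pochhammer b N"
      unfolding prod_dividef fact_prod_Suc pochhammer_prod
      by (simp add: atLeast0LessThan add_ac)
    \<comment> \<open>\<open>Gamma_series'\<close> has \<open>fact (N - 1)\<close> and exponent
      \<open>b\<close>; the spare factor \<open>N\<close> of \<open>fact N\<close> raises the
      exponent \<open>b - 1\<close> to \<open>b\<close>.\<close>
    also have "fact N / pochhammer b N * exp ((b - 1) * of_real (ln (real N))) = Gamma_series' b N"
    proof -
      have "exp (complex_of_real (ln (real N))) = of_nat N"
        using N by (simp add: exp_of_real)
      moreover have "(fact N :: complex) = of_nat N * fact (N - 1)"
        using N by (rule fact_reduce)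
      ultimately show ?thesis
        using N by (simp add: Gamma_series'_def left_diff_distrib exp_diff)
    qed
    finally show ?thesis .
  qed
  define K where "K = 48 * (norm b ^ 2 + norm b)"
  have K: "K \<ge> 0" by (simp add: K_def)
  have close: "norm (?T h - P N h) \<le> norm (P N h) * (K / (real N - 1))"
    if h: "0 < h" and N: "real N \<ge> 2 * norm b + 2" "16 * (norm b ^ 2 + norm b) \<le> real N - 1" for h N
  proof -
    define q where "q = complex_of_real (exp (- h))"
    have q: "norm q < 1" using h by (simp add: q_def)
    have N2: "real N > 1" using N norm_ge_zero[of b] by linarith
    define Y where "Y = qpoch_inf (exp (- (of_real h * (of_nat N + 1)))) q / qpoch_inf (exp (- (of_real h * (of_nat N + b)))) q
      * exp ((1 - b) * qlog h (of_nat N))"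
    have shift: "exp (- (of_real h * c)) * q ^ k = exp (- (of_real h * (of_nat k + c)))" for c k
      unfolding q_def by (simp add: exp_diff exp_minus exp_add ring_distribs field_simps flip: exp_of_real exp_of_nat_mult)
    have "qpoch_inf q q / qpoch_inf (exp (- (of_real h * b))) q =
      (\<Prod>k<N. (1 - exp (- (of_real h * (of_nat k + 1)))) / (1 - exp (- (of_real h * (of_nat k + b)))))
      * (qpoch_inf (exp (- (of_real h * (of_nat N + 1)))) q / qpoch_inf (exp (- (of_real h * (of_nat N + b)))) q)"
    proof -
      have "qpoch_inf q q = qpoch_inf (exp (- (of_real h * 1))) q" by (simp add: q_def exp_of_real[symmetric])
      then show ?thesis
        using qpoch_inf_split[OF q, of "exp (- (of_real h * 1))" N] qpoch_inf_split[OF q, of "exp (- (of_real h * b))" N]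
        unfolding shift prod_dividef by simp
    qed
    moreover have "exp ((1 - b) * of_real (ln (1 - exp (- h)))) =
       exp ((b - 1) * of_real (ln ((1 - exp (- (h * real N))) / (1 - exp (- h))))) * exp ((1 - b) * qlog h (of_nat N))"
    proof -
      have "0 < 1 - exp (- (h * real N))" "0 < 1 - exp (- h)" using h N2 by auto
      moreover have "qlog h (of_nat N) = of_real (ln (1 - exp (- (h * real N))))"
      proof -
        have "1 - exp (- (complex_of_real h * of_nat N)) = of_real (1 - exp (- (h * real N)))"
          by (simp add: exp_of_real[symmetric])
        then show ?thesis
          unfolding qlog_def using \<open>0 < 1 - exp (- (h * real N))\<close> by (simp only: Ln_of_real)
      qed
      ultimately show ?thesis
        using N2 by (auto simp: ln_div algebra_simps simp flip: exp_add)
    qed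
    ultimately have "?T h = P N h * Y"
      unfolding P_def Y_def q_def[symmetric] by (simp only: mult_ac)
    then have "norm (?T h - P N h) = norm (P N h) * norm (Y - 1)"
      by (simp add: algebra_simps flip: norm_mult)
    also have "norm (Y - 1) \<le> K / (real N - 1)"
      unfolding Y_def K_def q_def using h N by (rule qpoch_inf_tail_bound)
    finally show ?thesis by (simp add: mult_left_mono)
  qed
  show ?thesis
  proof (rule tendstoI)
    fix e :: real assume e: "e > 0"
    \<comment> \<open>Room of 1 for each of the two approximations, so that \<open>G\<close> bounds
      \<open>norm (P N h)\<close>.\<close>
    define G where "G = norm (Gamma b) + 2"
    have G: "G > 0" by (simp add: G_def add_nonneg_pos)
    have "\<forall>\<^sub>F N in sequentially. real N \<ge> max (2 * norm b + 2) (16 * (norm b ^ 2 + norm b) + 1)"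
      by (rule filterlim_real_sequentially[unfolded filterlim_at_top, rule_format])
    moreover have "\<forall>\<^sub>F N in sequentially. dist (Gamma_series' b N) (Gamma b) < min 1 (e / 3)"
      using e by (intro tendstoD[OF Gamma_series'_LIMSEQ]) auto
    moreover have "\<forall>\<^sub>F N in sequentially. G * (K / (real N - 1)) < e / 3"
    proof -
      have "(\<lambda>N. G * (K / (real N - 1))) \<longlonglongrightarrow> 0" by real_asymp
      then show ?thesis by (rule order_tendstoD) (use e in simp)
    qed
    ultimately have "\<forall>\<^sub>F N in sequentially. real N \<ge> max (2 * norm b + 2) (16 * (norm b ^ 2 + norm b) + 1) \<and>
        dist (Gamma_series' b N) (Gamma b) < min 1 (e / 3) \<and> G * (K / (real N - 1)) < e / 3"
      by eventually_elim auto
    then obtain N where N: "real N \<ge> max (2 * norm b + 2) (16 * (norm b ^ 2 + norm b) + 1)"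
        "dist (Gamma_series' b N) (Gamma b) < min 1 (e / 3)" "G * (K / (real N - 1)) < e / 3"
      by (auto simp: eventually_sequentially)
    have N0: "N > 0" "real N > 1" using N(1) norm_ge_zero[of b] by (auto simp del: norm_ge_zero)
    have "\<forall>\<^sub>F h in at_right 0. dist (P N h) (Gamma_series' b N) < min 1 (e / 3)"
      using e by (intro tendstoD[OF P_lim] N0) auto
    then show "\<forall>\<^sub>F h in at_right 0. dist (?T h) (Gamma b) < e"
      using eventually_at_right_less[of "0::real"]
    proof eventually_elim
      case (elim h)
      have "norm (P N h) \<le> norm (P N h - Gamma_series' b N) + norm (Gamma_series' b N - Gamma b) + norm (Gamma b)"
        by norm
      also have "\<dots> \<le> G" using elim N(2) by (simp add: G_def dist_norm)
      finally have PG: "norm (P N h) \<le> G" .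
      have "dist (?T h) (P N h) \<le> norm (P N h) * (K / (real N - 1))"
        unfolding dist_norm using elim N(1) by (intro close) auto
      also have "\<dots> \<le> G * (K / (real N - 1))"
        using K N0 PG by (intro mult_right_mono) auto
      also note N(3)
      finally have "dist (?T h) (P N h) < e / 3" .
      moreover have "dist (?T h) (Gamma b) \<le> dist (?T h) (P N h) + dist (P N h) (Gamma_series' b N) + dist (Gamma_series' b N) (Gamma b)"
        using dist_triangle[of "?T h" "Gamma b" "P N h"] dist_triangle[of "P N h" "Gamma b" "Gamma_series' b N"]
        by linarith
      ultimately show ?case using elim N(2) by simp
    qed
  qed
qed

section \<open>The limit of the transform\<close>

text \<open>A vanishing factor means that \<open>h * (c + k)\<close> is an integer multiple of
  \<open>2 * pi * \<i>\<close>. The bound on \<open>h * \<bar>Im c\<bar>\<close> leaves only the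
  multiple 0, that is \<open>c = - k\<close>.\<close>

lemma qpoch_inf_exp_mult_nonzero:
  assumes h: "0 < h" "h * \<bar>Im c\<bar> < 2 * pi" and c: "c \<notin> \<int>\<^sub>\<le>\<^sub>0"
  shows "qpoch_inf (exp (- (of_real h * c))) (of_real (exp (- h))) \<noteq> 0"
proof -
  have "1 - exp (- (of_real h * c)) * of_real (exp (- h)) ^ k \<noteq> 0" for k
  proof
    assume "1 - exp (- (of_real h * c)) * of_real (exp (- h)) ^ k = 0"
    moreover have "exp (- (of_real h * c)) * of_real (exp (- h)) ^ k = exp (- (of_real h * (c + of_nat k)))"
      by (simp add: exp_diff exp_minus exp_add ring_distribs field_simps flip: exp_of_real exp_of_nat_mult)
    ultimately have "exp (- (of_real h * (c + of_nat k))) = 1" by simp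
    then obtain n :: int where n: "h * (Re c + real k) = 0" "- (h * Im c) = of_int (2 * n) * pi"
      unfolding exp_eq_1 by auto
    have "\<bar>of_int n\<bar> * (2 * pi) = h * \<bar>Im c\<bar>"
      using arg_cong[OF n(2), of abs] h by (simp add: abs_mult)
    then have "\<bar>of_int n\<bar> * (2 * pi) < 1 * (2 * pi)" using h by simp
    then have "\<bar>real_of_int n\<bar> < 1" by (rule mult_right_less_imp_less) simp
    then have "n = 0" by linarith
    then have "c = - of_nat k" using n h by (auto simp: complex_eq_iff)
    then show False using c by auto
  qed
  then show ?thesis
    using h by (subst qpoch_inf_nonzero_iff) auto
qed

theorem theorem3:
  fixes lam x \<beta> :: complex
  assumes "lam \<noteq> 0" and "x \<noteq> 0" and "\<beta> \<notin> \<int>\<^sub>\<le>\<^sub>0"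
    and "\<beta> \<in> \<int> \<or> (lam \<notin> \<real>\<^sub>\<le>\<^sub>0 \<and> x / lam \<notin> \<real>\<^sub>\<le>\<^sub>0)"
  shows "((\<lambda>q::real. q_Laplace q lam (q_Borel q (one_psi_one 0 (of_real q powr \<beta>) q)) ((1 - q) * x))
      \<longlongrightarrow> Gamma \<beta> * branch_powr lam x (1 - \<beta>) * exp x)
      (at 1 within {q. 0 < q \<and> q < 1 \<and> (\<forall>n::int. lam \<noteq> of_real q powi n) \<and>
         (\<forall>n::int. theta q (lam * of_real q powi n / ((1 - q) * x)) \<noteq> 0)})"
proof -
  define S where "S = {q::real. 0 < q \<and> q < 1 \<and> (\<forall>n::int. lam \<noteq> of_real q powi n) \<and>
         (\<forall>n::int. theta q (lam * of_real q powi n / ((1 - q) * x)) \<noteq> 0)}"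
  let ?F = "at 1 within S"
  define s where "s = 1 - \<beta>"
  \<comment> \<open>The factor \<open>(1 - q) powr s\<close> is taken from \<open>X powi N\<close>
    or from the theta quotient at \<open>lam / X\<close>, so that \<open>T\<close> is the q-Gamma
    function.\<close>
  define T where "T q = qpoch_inf (of_real q) (of_real q) / qpoch_inf (of_real q powr \<beta>) (of_real q) * exp (s * of_real (ln (1 - q)))" for q :: real
  define L where "L q = q_Laplace q lam (q_Borel q (one_psi_one 0 (of_real q powr \<beta>) q)) ((1 - q) * x)" for q :: real
  define E where "E q = qpoch_inf ((1 - q) * x) (of_real q)" for q :: real
  have inS: "\<forall>\<^sub>F q in ?F. q \<in> S"
    by (simp add: eventually_at_filter)
  have hlim: "filterlim (\<lambda>q. - ln q) (at_right 0) ?F"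
  proof -
    have "((\<lambda>q::real. - ln q) \<longlongrightarrow> - ln 1) ?F" by (intro tendsto_intros) auto
    moreover have "\<forall>\<^sub>F q in ?F. - ln q \<in> {0<..} \<and> - ln q \<noteq> 0"
      using inS by eventually_elim (auto simp: S_def)
    ultimately show ?thesis unfolding filterlim_at by simp
  qed
  have T_lim: "(T \<longlongrightarrow> Gamma \<beta>) ?F"
  proof (rule Lim_transform_eventually[OF filterlim_compose[OF q_Gamma_tendsto[OF assms(3)] hlim]])
    show "\<forall>\<^sub>F q in ?F. qpoch_inf (of_real (exp (- (- ln q)))) (of_real (exp (- (- ln q)))) / qpoch_inf (exp (- (of_real (- ln q) * \<beta>))) (of_real (exp (- (- ln q))))
      * exp ((1 - \<beta>) * of_real (ln (1 - exp (- (- ln q))))) = T q"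
      using inS by eventually_elim (auto simp: S_def T_def s_def powr_def Ln_of_real mult.commute)
  qed
  have E_lim: "(E \<longlongrightarrow> exp (- x)) ?F"
  proof (rule Lim_transform_eventually[OF filterlim_compose[OF qpoch_inf_exp_tendsto hlim]])
    show "\<forall>\<^sub>F q in ?F. qpoch_inf (of_real (1 - exp (- (- ln q))) * x) (of_real (exp (- (- ln q)))) = E q"
      using inS by eventually_elim (auto simp: S_def E_def)
  qed
  have TE_lim: "((\<lambda>q. T q / E q) \<longlongrightarrow> Gamma \<beta> * exp x) ?F"
    using tendsto_divide[OF T_lim E_lim] by (simp add: exp_minus field_simps)
  have small: "\<forall>\<^sub>F q in ?F. norm ((1 - q) * x) < 1"
  proof -
    have "((\<lambda>q. norm ((1 - q) * x)) \<longlongrightarrow> norm (of_real (1 - 1) * x)) ?F" by (intro tendsto_intros)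
    then show ?thesis by (rule order_tendstoD) simp
  qed
  have "((\<lambda>q. L q) \<longlongrightarrow> Gamma \<beta> * exp x * branch_powr lam x s) ?F"
  \<comment> \<open>For a positive integer \<open>\<beta>\<close> the factor
    \<open>qpoch_inf (q / b) q\<close> is 0 and \<open>q_Laplace_Borel_generic\<close> does not
    apply; there the power of \<open>x\<close> is exact before the limit.\<close>
  proof (cases "\<beta> \<in> \<int>")
    case True
    then obtain j where j: "\<beta> = of_int j" by (elim Ints_cases)
    then have "j > 0" using assms(3) by (metis nonpos_Ints_of_int not_le)
    define N where "N = 1 - j"
    have s: "s = of_int N" by (simp add: s_def N_def j)
    have "\<forall>\<^sub>F q in ?F. T q / E q * x powi N = L q"
      using inS small
    proof eventually_elim
      case (elim q)
      then have q: "0 < q" "q < 1" by (auto simp: S_def)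
      have "of_real q powr \<beta> = complex_of_real q powi (1 - N)"
        unfolding j using q by (simp add: N_def complex_powr_of_int)
      \<comment> \<open>The instance \<open>n = 0\<close> of the condition in \<open>S\<close> is
        the nonvanishing of \<open>theta q (lam / X)\<close>.\<close>
      moreover have "theta q (lam * of_real q powi 0 / ((1 - q) * x)) \<noteq> 0"
        using elim unfolding S_def by blast
      then have "L q = qpoch_inf q q / qpoch_inf (of_real q powi (1 - N)) q / E q * ((1 - q) * x) powi N"
        unfolding L_def E_def calculation
        using assms q elim \<open>j > 0\<close>
        by (intro q_Laplace_Borel_integer) (auto simp: N_def)
      moreover have "exp (s * of_real (ln (1 - q))) = of_real (1 - q) powi N"
        using q unfolding s exp_power_int[symmetric] exp_of_real by simp
      ultimately show ?case
        unfolding T_def by (simp add: power_int_mult_distrib)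
    qed
    moreover have "((\<lambda>q. T q / E q * x powi N) \<longlongrightarrow> Gamma \<beta> * exp x * x powi N) ?F"
      by (intro tendsto_mult TE_lim tendsto_const)
    ultimately show ?thesis
      unfolding s branch_powr_of_int[OF assms(1,2)] by (rule Lim_transform_eventually[rotated])
  next
    case False
    then have lam: "lam \<notin> \<real>\<^sub>\<le>\<^sub>0" and xlam: "x / lam \<notin> \<real>\<^sub>\<le>\<^sub>0" using assms(4) by auto
    have inv: "Ln (lam / x) = - Ln (x / lam)"
      using Ln_inverse[OF xlam] by simp
    \<comment> \<open>Both logarithms lie strictly inside the strip because \<open>lam\<close> and
      \<open>x / lam\<close> avoid the cut. Division by the positive real \<open>1 - q\<close> keeps
      the imaginary part, so \<open>W\<close> obeys the same bound.\<close>
    define \<phi> where "\<phi> = max \<bar>Im (Ln lam)\<bar> \<bar>Im (Ln (lam / x))\<bar>"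
    have phi: "\<phi> < pi"
      using Im_Ln_less_pi[OF lam] Im_Ln_less_pi[OF xlam] mpi_less_Im_Ln[of lam] mpi_less_Im_Ln[of "x / lam"] assms(1,2)
      unfolding \<phi>_def inv by (auto simp: abs_less_iff)
    define W where "W h = Ln (lam / x) - of_real (ln (1 - exp (- h)))" for h :: real
    define R where "R w h = theta (of_real (exp (- h))) (exp (w - s * of_real h)) / theta (of_real (exp (- h))) (exp w) * exp (s * w)" for w h
    have R1: "((\<lambda>q. R (Ln lam) (- ln q)) \<longlongrightarrow> 1) ?F"
      unfolding R_def by (rule filterlim_compose[OF theta_quotient_tendsto[OF phi] hlim]) (simp add: \<phi>_def)
    have R2: "((\<lambda>q. R (W (- ln q)) (- ln q)) \<longlongrightarrow> 1) ?F"
      unfolding R_def by (rule filterlim_compose[OF theta_quotient_tendsto[OF phi] hlim]) (simp add: \<phi>_def W_def)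
    define B where "B = exp (s * Ln lam) * exp (s * Ln (x / lam))"
    have B: "branch_powr lam x s = B"
      using assms(1,2) by (simp add: branch_powr_def powr_def B_def)
    have "((\<lambda>q. T q / E q * (R (W (- ln q)) (- ln q) / R (Ln lam) (- ln q)) * B) \<longlongrightarrow> Gamma \<beta> * exp x * (1 / 1) * B) ?F"
      by (intro tendsto_mult TE_lim tendsto_divide R1 R2 tendsto_const) auto
    moreover have "\<forall>\<^sub>F q in ?F. T q / E q * (R (W (- ln q)) (- ln q) / R (Ln lam) (- ln q)) * B = L q"
    proof -
      \<comment> \<open>Since \<open>Im s = - Im \<beta>\<close>, this one bound yields the
        nonvanishing for both \<open>b\<close> and \<open>q / b\<close>.\<close>
      have "((\<lambda>q. - ln q * \<bar>Im \<beta>\<bar>) \<longlongrightarrow> - ln 1 * \<bar>Im \<beta>\<bar>) ?F" by (intro tendsto_intros) auto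
      then have e1: "\<forall>\<^sub>F q in ?F. - ln q * \<bar>Im \<beta>\<bar> < 2 * pi" by (rule order_tendstoD) simp
      \<comment> \<open>Keeps \<open>Ln lam - s * h\<close> in the strip, so that
        \<open>theta q (q / b * lam)\<close> is nonzero.\<close>
      have "((\<lambda>q. \<bar>Im (Ln lam - s * of_real (- ln q))\<bar>) \<longlongrightarrow> \<bar>Im (Ln lam - s * of_real (- ln 1))\<bar>) ?F"
        by (intro tendsto_intros) auto
      then have e2: "\<forall>\<^sub>F q in ?F. \<bar>Im (Ln lam - s * of_real (- ln q))\<bar> < pi"
        by (rule order_tendstoD) (use phi in \<open>simp add: \<phi>_def\<close>)
      show ?thesis
        using inS small e1 e2
      proof eventually_elim
        case (elim q)
        then have q: "0 < q" "q < 1" by (auto simp: S_def)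
        define h where "h = - ln q"
        have h: "0 < h" "exp (- h) = q" using q by (auto simp: h_def)
        define b where "b = complex_of_real q powr \<beta>"
        have b: "b = exp (- (of_real h * \<beta>))" "b \<noteq> 0"
          using q by (auto simp: b_def powr_def Ln_of_real h_def mult.commute)
        have qb: "of_real q / b = exp (- (of_real h * s))"
          unfolding b h(2)[symmetric] exp_of_real[symmetric] by (simp add: s_def exp_diff[symmetric] algebra_simps)
        define X where "X = (1 - q) * x"
        have X: "X \<noteq> 0" using q assms by (simp add: X_def)
        have bnz: "qpoch_inf b q \<noteq> 0"
          unfolding b h(2)[symmetric] using h elim assms by (intro qpoch_inf_exp_mult_nonzero) (auto simp: h_def)
        have snon: "s \<notin> \<int>\<^sub>\<le>\<^sub>0"
        proof
          assume "s \<in> \<int>\<^sub>\<le>\<^sub>0"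
          then have "1 - s \<in> \<int>" by (metis Ints_1 Ints_diff nonpos_Ints_Int)
          moreover have "1 - s = \<beta>" by (simp add: s_def)
          ultimately show False using \<open>\<beta> \<notin> \<int>\<close> by metis
        qed
        have "qpoch_inf (exp (- (of_real h * s))) (of_real (exp (- h))) \<noteq> 0"
          using h elim snon by (intro qpoch_inf_exp_mult_nonzero) (auto simp: h_def s_def)
        then have qbnz: "qpoch_inf (q / b) q \<noteq> 0"
          unfolding qb h(2) .
        have arg1: "exp (Ln lam - s * of_real h) = of_real q / b * lam" "exp (Ln lam) = lam"
          unfolding qb using assms(1) by (simp_all add: exp_diff exp_minus field_simps)
        have eW: "exp (W h) = lam / X"
          using q assms unfolding W_def h(2) X_def by (simp add: exp_diff exp_of_real)
        have arg2: "exp (W h - s * of_real h) = of_real q / b * (lam / X)"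
          unfolding qb eW[symmetric] by (simp add: exp_diff exp_minus field_simps)
        have t1: "theta q (of_real q / b * lam) \<noteq> 0"
          using theta_exp_nonzero[OF h(1), of "Ln lam - s * of_real h"] elim unfolding arg1 h(2) h_def[symmetric] by blast
        have L: "L q = qpoch_inf q q / qpoch_inf b q / E q * (theta q lam / theta q (q / b * lam))
            * (theta q (q / b * (lam / X)) / theta q (lam / X))"
          unfolding L_def E_def b_def[symmetric] X_def[symmetric]
          using assms q elim X b bnz qbnz t1 by (intro q_Laplace_Borel_generic) (auto simp: X_def)
        \<comment> \<open>\<open>W h\<close> is \<open>- Ln (x / lam)\<close> minus the logarithm of
          \<open>1 - q\<close>, so the three exponents add up to 0.\<close>
        have expW: "exp (s * W h) * exp (s * of_real (ln (1 - q))) * exp (s * Ln (x / lam)) = 1"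
          unfolding exp_add[symmetric] W_def inv h(2) by (simp add: algebra_simps)
        have R1: "R (Ln lam) h = theta q (q / b * lam) / theta q lam * exp (s * Ln lam)"
          unfolding R_def arg1 h(2) ..
        have R2: "R (W h) h = theta q (q / b * (lam / X)) / theta q (lam / X) * exp (s * W h)"
          unfolding R_def arg2 eW h(2) ..
        have "T q / E q * (R (W h) h / R (Ln lam) h) * B = L q *
           (exp (s * W h) * exp (s * of_real (ln (1 - q))) * exp (s * Ln (x / lam)))"
          unfolding R1 R2 L T_def B_def b_def[symmetric] by (simp add: mult_ac)
        then show ?case unfolding expW mult_1_right unfolding h_def .
      qed
    qed
    ultimately show ?thesis
      unfolding B div_by_1 mult_1_right by (rule Lim_transform_eventually)
  qed
  then show ?thesis
    unfolding L_def s_def S_def by (simp add: mult_ac)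
qed

end
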